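(* $P\Sigma_1$ proves the totality of the Ackermann–Péter function, i.e. $P\Sigma_1\vdash\forall m\,\forall n\,\exists k\,\phi_A(m,n,k)$, where $\phi_A(m,n,k)$ is the natural $\Sigma_1$-formula defining the graph of the Ackermann–Péter function $A$.
   Context: The Ackermann–Péter function is given by $A(0,n)=n+1$, $A(m,0)=A(m-1,1)$ for $m>0$, and $A(m,n)=A(m-1,A(m,n-1))$ for $m,n>0$; $\phi_A(m,n,k)$ is the $\Sigma_1$-formula expressing (via existence of a coded finite computation) that $A(m,n)=k$. $I\Sigma_1$ is Peano arithmetic without induction plus induction for $\Sigma_1$-formulas. Finite sequences are coded by numbers; $\mathrm{lth}(s)$ is the length and $(s)_i$ the $i$-th entry. For a formula $\phi(x,y)$ (possibly with parameters), $\mathsf{PFUN}(\phi)$ states that for each $x$ there is at most one $y$ with $\phi(x,y)$; $\mathsf{Approx}_\phi(s)$ states that $s$ codes a finite sequence such that for all $i<\mathrm{lth}(s)-1$ and all $x,y$, if $x\le(s)_i$ and $\phi(x,y)$ then $y\le(s)_{i+1}$; $P\phi$ is $\mathsf{PFUN}(\phi)\to\forall z\,\exists s\,(\mathsf{Approx}_\phi(s)\wedge\mathrm{lth}(s)=z)$. $P\Sigma_1$ is $I\Sigma_1$ plus all $P\phi$ with $\phi\in\Sigma_1$. *)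

theory Defs
  imports Main
begin

text \<open>
  First-order logic over the language of arithmetic with 0, successor, addition, multiplication,
  order and equality.  Bound variables are de Bruijn indices: \<open>Var 0\<close> refers to the innermost
  enclosing quantifier.
\<close>

datatype tm =
    Var nat
  | Zero
  | Succ tm
  | Add tm tm  (infixl "\<^bold>+" 65)
  | Mul tm tm  (infixl "\<^bold>*" 70)

datatype fm =
    Fls
  | Eq tm tm    (infix "\<^bold>=" 50)
  | Less tm tm  (infix "\<^bold><" 50)
  | Conj fm fm  (infixr "\<^bold>\<and>" 35)
  | Disj fm fm  (infixr "\<^bold>\<or>" 30)
  | Imp fm fm   (infixr "\<^bold>\<longrightarrow>" 25)
  | Forall fm
  | Exists fm

abbreviation Neg :: "fm \<Rightarrow> fm" where
  "Neg p \<equiv> p \<^bold>\<longrightarrow> Fls"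

abbreviation Iff :: "fm \<Rightarrow> fm \<Rightarrow> fm" where
  "Iff p q \<equiv> (p \<^bold>\<longrightarrow> q) \<^bold>\<and> (q \<^bold>\<longrightarrow> p)"

abbreviation Le :: "tm \<Rightarrow> tm \<Rightarrow> fm"  (infix "\<^bold>\<le>" 50) where
  "t \<^bold>\<le> u \<equiv> t \<^bold>< u \<^bold>\<or> t \<^bold>= u"

primrec substt :: "(nat \<Rightarrow> tm) \<Rightarrow> tm \<Rightarrow> tm" where
  "substt \<sigma> (Var i) = \<sigma> i"
| "substt \<sigma> Zero = Zero"
| "substt \<sigma> (Succ t) = Succ (substt \<sigma> t)"
| "substt \<sigma> (t \<^bold>+ u) = substt \<sigma> t \<^bold>+ substt \<sigma> u"
| "substt \<sigma> (t \<^bold>* u) = substt \<sigma> t \<^bold>* substt \<sigma> u"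

definition liftt :: "nat \<Rightarrow> tm \<Rightarrow> tm" where
  "liftt d t = substt (\<lambda>i. Var (i + d)) t"

definition under :: "(nat \<Rightarrow> tm) \<Rightarrow> nat \<Rightarrow> tm" where
  "under \<sigma> i = (case i of 0 \<Rightarrow> Var 0 | Suc j \<Rightarrow> liftt 1 (\<sigma> j))"

primrec subst :: "(nat \<Rightarrow> tm) \<Rightarrow> fm \<Rightarrow> fm" where
  "subst \<sigma> Fls = Fls"
| "subst \<sigma> (t \<^bold>= u) = (substt \<sigma> t \<^bold>= substt \<sigma> u)"
| "subst \<sigma> (t \<^bold>< u) = (substt \<sigma> t \<^bold>< substt \<sigma> u)"
| "subst \<sigma> (p \<^bold>\<and> q) = (subst \<sigma> p \<^bold>\<and> subst \<sigma> q)"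
| "subst \<sigma> (p \<^bold>\<or> q) = (subst \<sigma> p \<^bold>\<or> subst \<sigma> q)"
| "subst \<sigma> (p \<^bold>\<longrightarrow> q) = (subst \<sigma> p \<^bold>\<longrightarrow> subst \<sigma> q)"
| "subst \<sigma> (Forall p) = Forall (subst (under \<sigma>) p)"
| "subst \<sigma> (Exists p) = Exists (subst (under \<sigma>) p)"

definition lift :: "nat \<Rightarrow> fm \<Rightarrow> fm" where
  "lift d p = subst (\<lambda>i. Var (i + d)) p"

text \<open>
  The first variables of \<open>p\<close> are replaced by the terms \<open>ts\<close>; the remaining ones are parameters,
  and \<open>d\<close> is the number of quantifiers under which the instance is placed, counted from the
  context of the parameters.  Hence \<open>inst 0 [t] p\<close> is the formula that results from \<open>Forall p\<close> or
  \<open>Exists p\<close> by dropping the quantifier and putting \<open>t\<close> for its variable.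
\<close>

definition inst :: "nat \<Rightarrow> tm list \<Rightarrow> fm \<Rightarrow> fm" where
  "inst d ts p =
     subst (\<lambda>i. if i < length ts then ts ! i else Var (i - length ts + d)) p"

inductive provable :: "fm set \<Rightarrow> fm \<Rightarrow> bool"  (infix "\<turnstile>" 20) where
  Assm:   "p \<in> \<Gamma> \<Longrightarrow> \<Gamma> \<turnstile> p"
| Boole:  "insert (Neg p) \<Gamma> \<turnstile> Fls \<Longrightarrow> \<Gamma> \<turnstile> p"
| ImpI:   "insert p \<Gamma> \<turnstile> q \<Longrightarrow> \<Gamma> \<turnstile> p \<^bold>\<longrightarrow> q"
| ImpE:   "\<Gamma> \<turnstile> p \<^bold>\<longrightarrow> q \<Longrightarrow> \<Gamma> \<turnstile> p \<Longrightarrow> \<Gamma> \<turnstile> q"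
| ConjI:  "\<Gamma> \<turnstile> p \<Longrightarrow> \<Gamma> \<turnstile> q \<Longrightarrow> \<Gamma> \<turnstile> p \<^bold>\<and> q"
| ConjE1: "\<Gamma> \<turnstile> p \<^bold>\<and> q \<Longrightarrow> \<Gamma> \<turnstile> p"
| ConjE2: "\<Gamma> \<turnstile> p \<^bold>\<and> q \<Longrightarrow> \<Gamma> \<turnstile> q"
| DisjI1: "\<Gamma> \<turnstile> p \<Longrightarrow> \<Gamma> \<turnstile> p \<^bold>\<or> q"
| DisjI2: "\<Gamma> \<turnstile> q \<Longrightarrow> \<Gamma> \<turnstile> p \<^bold>\<or> q"
| DisjE:  "\<Gamma> \<turnstile> p \<^bold>\<or> q \<Longrightarrow> insert p \<Gamma> \<turnstile> r \<Longrightarrow> insert q \<Gamma> \<turnstile> r \<Longrightarrow> \<Gamma> \<turnstile> r"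
| AllI:   "lift 1 ` \<Gamma> \<turnstile> p \<Longrightarrow> \<Gamma> \<turnstile> Forall p"
| AllE:   "\<Gamma> \<turnstile> Forall p \<Longrightarrow> \<Gamma> \<turnstile> inst 0 [t] p"
| ExI:    "\<Gamma> \<turnstile> inst 0 [t] p \<Longrightarrow> \<Gamma> \<turnstile> Exists p"
| ExE:    "\<Gamma> \<turnstile> Exists p \<Longrightarrow> insert p (lift 1 ` \<Gamma>) \<turnstile> lift 1 q \<Longrightarrow> \<Gamma> \<turnstile> q"
| EqRefl: "\<Gamma> \<turnstile> t \<^bold>= t"
| EqSubst: "\<Gamma> \<turnstile> t \<^bold>= u \<Longrightarrow> \<Gamma> \<turnstile> inst 0 [t] p \<Longrightarrow> \<Gamma> \<turnstile> inst 0 [u] p"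

definition ball :: "tm \<Rightarrow> fm \<Rightarrow> fm" where
  "ball t p = Forall (Var 0 \<^bold>< liftt 1 t \<^bold>\<longrightarrow> p)"

definition bex :: "tm \<Rightarrow> fm \<Rightarrow> fm" where
  "bex t p = Exists (Var 0 \<^bold>< liftt 1 t \<^bold>\<and> p)"

inductive delta0 :: "fm \<Rightarrow> bool" where
  "delta0 Fls"
| "delta0 (t \<^bold>= u)"
| "delta0 (t \<^bold>< u)"
| "delta0 p \<Longrightarrow> delta0 q \<Longrightarrow> delta0 (p \<^bold>\<and> q)"
| "delta0 p \<Longrightarrow> delta0 q \<Longrightarrow> delta0 (p \<^bold>\<or> q)"
| "delta0 p \<Longrightarrow> delta0 q \<Longrightarrow> delta0 (p \<^bold>\<longrightarrow> q)"
| "delta0 p \<Longrightarrow> delta0 (ball t p)"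
| "delta0 p \<Longrightarrow> delta0 (bex t p)"

inductive sigma1 :: "fm \<Rightarrow> bool" where
  "delta0 p \<Longrightarrow> sigma1 p"
| "sigma1 p \<Longrightarrow> sigma1 (Exists p)"

text \<open>
  The pairing \<open>\<langle>t, u\<rangle> = (t + u)\<^sup>2 + t\<close> is injective, and a term.  A sequence code is a number
  \<open>\<langle>l, \<langle>a, b\<rangle>\<rangle>\<close>; it has length \<open>l\<close>, and its \<open>i\<close>-th entry (for \<open>i < l\<close>) is the value of
  Goedel's beta function, the remainder of \<open>a\<close> modulo \<open>b (i + 1) + 1\<close>.
\<close>

definition pair :: "tm \<Rightarrow> tm \<Rightarrow> tm" where
  "pair t u = (t \<^bold>+ u) \<^bold>* (t \<^bold>+ u) \<^bold>+ t"

text \<open>\<open>lth s l\<close>: \<open>s\<close> codes a finite sequence, and its length is \<open>l\<close>\<close>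

definition lth :: "tm \<Rightarrow> tm \<Rightarrow> fm" where
  "lth s l =
     bex (Succ s) (bex (Succ (liftt 1 s))
       (liftt 2 s \<^bold>= pair (liftt 2 l) (pair (Var 1) (Var 0))))"

text \<open>\<open>entry s i y\<close>: \<open>s\<close> codes a finite sequence, \<open>i\<close> is smaller than its length, and \<open>(s)\<^sub>i = y\<close>\<close>

definition entry :: "tm \<Rightarrow> tm \<Rightarrow> tm \<Rightarrow> fm" where
  "entry s i y =
     bex (Succ s) (bex (Succ (liftt 1 s)) (bex (Succ (liftt 2 s))
       (liftt 3 s \<^bold>= pair (Var 2) (pair (Var 1) (Var 0)) \<^bold>\<and>
        liftt 3 i \<^bold>< Var 2 \<^bold>\<and>
        liftt 3 y \<^bold>< Succ (Var 0 \<^bold>* Succ (liftt 3 i)) \<^bold>\<and>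
        bex (Succ (Var 1))
          (Var 2 \<^bold>= Var 0 \<^bold>* Succ (Var 1 \<^bold>* Succ (liftt 4 i)) \<^bold>+ liftt 4 y))))"

text \<open>Universal closure; \<open>fv p\<close> is the least \<open>k\<close> such that all free variables of \<open>p\<close> are below \<open>k\<close>.\<close>

primrec fvt :: "tm \<Rightarrow> nat" where
  "fvt (Var i) = Suc i"
| "fvt Zero = 0"
| "fvt (Succ t) = fvt t"
| "fvt (t \<^bold>+ u) = max (fvt t) (fvt u)"
| "fvt (t \<^bold>* u) = max (fvt t) (fvt u)"

primrec fv :: "fm \<Rightarrow> nat" where
  "fv Fls = 0"
| "fv (t \<^bold>= u) = max (fvt t) (fvt u)"
| "fv (t \<^bold>< u) = max (fvt t) (fvt u)"
| "fv (p \<^bold>\<and> q) = max (fv p) (fv q)"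
| "fv (p \<^bold>\<or> q) = max (fv p) (fv q)"
| "fv (p \<^bold>\<longrightarrow> q) = max (fv p) (fv q)"
| "fv (Forall p) = fv p - 1"
| "fv (Exists p) = fv p - 1"

definition ucl :: "fm \<Rightarrow> fm" where
  "ucl p = (Forall ^^ fv p) p"

text \<open>
  Peano arithmetic without induction.  The laws of discretely ordered semirings are not
  included, since they follow from these axioms by induction.
\<close>

definition PA_basic :: "fm set" where
  "PA_basic = ucl `
    {Neg (Succ (Var 0) \<^bold>= Zero),
     Succ (Var 0) \<^bold>= Succ (Var 1) \<^bold>\<longrightarrow> Var 0 \<^bold>= Var 1,
     Var 0 \<^bold>+ Zero \<^bold>= Var 0,
     Var 0 \<^bold>+ Succ (Var 1) \<^bold>= Succ (Var 0 \<^bold>+ Var 1),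
     Var 0 \<^bold>* Zero \<^bold>= Zero,
     Var 0 \<^bold>* Succ (Var 1) \<^bold>= Var 0 \<^bold>* Var 1 \<^bold>+ Var 0,
     Neg (Var 0 \<^bold>< Zero),
     Iff (Var 0 \<^bold>< Succ (Var 1)) (Var 0 \<^bold>< Var 1 \<^bold>\<or> Var 0 \<^bold>= Var 1)}"

text \<open>Induction on the variable 0 of \<open>p\<close>; the other variables are parameters.\<close>

definition induction_ax :: "fm \<Rightarrow> fm" where
  "induction_ax p =
     (inst 0 [Zero] p \<^bold>\<and> Forall (p \<^bold>\<longrightarrow> inst 1 [Succ (Var 0)] p) \<^bold>\<longrightarrow> Forall p)"

definition ISigma1 :: "fm set" where
  "ISigma1 = PA_basic \<union> {ucl (induction_ax p) | p. sigma1 p}"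

text \<open>
  In \<open>p\<close> read as \<open>\<phi>(x, y)\<close>, \<open>x\<close> is the variable 0, \<open>y\<close> is the variable 1, and the other variables
  are parameters.
\<close>

definition PFUN :: "fm \<Rightarrow> fm" where
  "PFUN p =
     Forall (Forall (Forall
       (inst 3 [Var 2, Var 1] p \<^bold>\<and> inst 3 [Var 2, Var 0] p \<^bold>\<longrightarrow> Var 1 \<^bold>= Var 0)))"

text \<open>
  In \<open>Approx d p s\<close> the number \<open>d\<close> is that of the quantifiers between the context of the parameters
  of \<open>p\<close> and this formula, as in \<open>inst\<close>.  The quantified variables are the length \<open>l\<close>, then \<open>i\<close>, then
  \<open>u = (s)\<^sub>i\<close> and \<open>v = (s)\<^sub>i\<^sub>+\<^sub>1\<close>, then \<open>x\<close> and \<open>y\<close>.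
\<close>

definition Approx :: "nat \<Rightarrow> fm \<Rightarrow> tm \<Rightarrow> fm" where
  "Approx d p s =
     Exists (lth (liftt 1 s) (Var 0) \<^bold>\<and>
       Forall (Succ (Var 0) \<^bold>< Var 1 \<^bold>\<longrightarrow>
         Exists (Exists (entry (liftt 4 s) (Var 2) (Var 1) \<^bold>\<and> entry (liftt 4 s) (Succ (Var 2)) (Var 0) \<^bold>\<and>
           Forall (Forall (Var 1 \<^bold>\<le> Var 3 \<^bold>\<and> inst (d + 6) [Var 1, Var 0] p \<^bold>\<longrightarrow> Var 0 \<^bold>\<le> Var 2))))))"

definition P_ax :: "fm \<Rightarrow> fm" where
  "P_ax p = (PFUN p \<^bold>\<longrightarrow> Forall (Exists (Approx 2 p (Var 0) \<^bold>\<and> lth (Var 0) (Var 1))))"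

definition PSigma1 :: "fm set" where
  "PSigma1 = ISigma1 \<union> {ucl (P_ax p) | p. sigma1 p}"

text \<open>\<open>before s i t\<close>: \<open>t\<close> is an entry of \<open>s\<close> with index smaller than \<open>i\<close>\<close>

definition before :: "tm \<Rightarrow> tm \<Rightarrow> tm \<Rightarrow> fm" where
  "before s i t = bex i (entry (liftt 1 s) (Var 0) (liftt 1 t))"

definition triple :: "tm \<Rightarrow> tm \<Rightarrow> tm \<Rightarrow> tm" where
  "triple t u v = pair t (pair u v)"

text \<open>
  \<open>s\<close> codes a computation: a finite sequence of triples \<open>\<langle>m, n, k\<rangle>\<close>, each of which follows from
  earlier ones by one of the three recursion equations.  The quantified variables are the length \<open>l\<close>,
  the index \<open>i\<close>, then \<open>m\<close>, \<open>n\<close>, \<open>k\<close>; in the second recursion equation in addition \<open>m' = m - 1\<close>;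
  in the third one in addition \<open>m' = m - 1\<close>, \<open>n' = n - 1\<close> and the intermediate value \<open>c\<close> of
  \<open>A(m, n')\<close>.
\<close>

definition ack_comp :: "tm \<Rightarrow> fm" where
  "ack_comp s =
     bex (Succ s) (lth (liftt 1 s) (Var 0) \<^bold>\<and>
       ball (Var 0)
         (bex (Succ (liftt 2 s)) (bex (Succ (liftt 3 s)) (bex (Succ (liftt 4 s))
           (entry (liftt 5 s) (Var 3) (triple (Var 2) (Var 1) (Var 0)) \<^bold>\<and>
            ((Var 2 \<^bold>= Zero \<^bold>\<and> Var 0 \<^bold>= Succ (Var 1)) \<^bold>\<or>
             bex (Succ (liftt 5 s))
               (Var 3 \<^bold>= Succ (Var 0) \<^bold>\<and> Var 2 \<^bold>= Zero \<^bold>\<and>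
                before (liftt 6 s) (Var 4) (triple (Var 0) (Succ Zero) (Var 1))) \<^bold>\<or>
             bex (Succ (liftt 5 s)) (bex (Succ (liftt 6 s)) (bex (Succ (liftt 7 s))
               (Var 5 \<^bold>= Succ (Var 2) \<^bold>\<and> Var 4 \<^bold>= Succ (Var 1) \<^bold>\<and>
                before (liftt 8 s) (Var 6) (triple (Var 5) (Var 1) (Var 0)) \<^bold>\<and>
                before (liftt 8 s) (Var 6) (triple (Var 2) (Var 0) (Var 3)))))))))))"

text \<open>\<open>A(m, n) = k\<close>: there is a computation \<open>s\<close> in which \<open>\<langle>m, n, k\<rangle>\<close> occurs
  (its index is below the length of \<open>s\<close>, hence below \<open>s + 1\<close>).\<close>

definition phi_A :: "tm \<Rightarrow> tm \<Rightarrow> tm \<Rightarrow> fm" where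
  "phi_A m n k =
     Exists (ack_comp (Var 0) \<^bold>\<and>
         before (Var 0) (Succ (Var 0)) (triple (liftt 1 m) (liftt 1 n) (liftt 1 k)))"

lemma sigma1_phi_A: "sigma1 (phi_A m n k)"
  unfolding phi_A_def ack_comp_def before_def entry_def lth_def
  by (intro sigma1.intros delta0.intros)

end

theory Submission
  imports Defs "HOL-Library.Countable"
begin

text \<open>
  By Henkin's completeness theorem it suffices to argue in a countable model of \<^const>\<open>PSigma1\<close>, where
  sequences are available through the beta function.  Fix \<open>m\<^sub>0\<close> and \<open>n\<^sub>0\<close> and let \<open>F\<close> map
  \<open>\<langle>m, n\<rangle>\<close> to the least bound on a computation of \<open>A(m, n)\<close>.  This is a partial function with
  a bounded definition, so the principle \<open>P\<close> yields an approximation \<open>s\<close> of length \<open>m\<^sub>0 + 2\<close>.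
  By induction on \<open>j \<le> m\<^sub>0\<close>, the values \<open>A(j, n)\<close> exist for all \<open>n\<close> with
  \<open>\<langle>m\<^sub>0, n\<rangle> \<le> (s)\<^sub>i\<close>, where \<open>i = m\<^sub>0 - j + 1\<close>.  The entries of \<open>s\<close> bound all quantifiers over
  arguments, so this is a \<open>\<Sigma>\<^sub>1\<close> induction, although totality of \<open>A(j, _)\<close> is a \<open>\<Pi>\<^sub>2\<close> statement.
\<close>

section \<open>Semantics and substitution\<close>

text \<open>The calculus offers bare introduction and elimination rules, and \<open>PA_basic\<close>
  little more than recursion equations; ordered semiring laws, division and coding must all be won
  by \<Sigma>_1 induction. Turning the model into a HOL type makes this ordinary HOL reasoning; what
  remains to be watched is definability, handled by closure rules for \<open>is_delta0\<close> and
  \<open>is_sigma1\<close>. The principle P applies only to partial functions. The graph of A would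
  first need a proof that its values are unique. A least bound is unique by construction, and
  minimality for a \<Delta>_0 property is again \<Delta>_0. A bound on a whole computation also
  bounds the value, which is the next argument of the recursion. Entries are compared with the pair
  of \<open>m\<^sub>0\<close> and n rather than with n: pairing is monotone, so this pair dominates
  the pair of j and n for every j up to \<open>m\<^sub>0\<close>, and one entry controls F on all
  rows. The equation A(j+1, n+1) = A(j, A(j+1, n)) applies the bound once per row. Hence
  \<open>m\<^sub>0\<close> iterations of the bound are called for, and for nonstandard
  \<open>m\<^sub>0\<close> this is what P supplies.\<close>

instance tm :: countable
  by countable_datatype

text \<open>Countability of formulas drives the Henkin construction; that of terms lets the elements
  of the model be enumerated as parameters.\<close>

instance fm :: countable
  by countable_datatype

text \<open>\<open>Succ\<close> is read as adding 1, so that a structure is given by operations of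
  HOL type classes alone. \<open>Succ_completion\<close> justifies this reading in the term
  model.\<close>

primrec eval :: "(nat \<Rightarrow> 'a::{zero,one,plus,times}) \<Rightarrow> tm \<Rightarrow> 'a" where
  "eval e (Var i) = e i"
| "eval e Zero = 0"
| "eval e (Succ t) = eval e t + 1"
| "eval e (t \<^bold>+ u) = eval e t + eval e u"
| "eval e (t \<^bold>* u) = eval e t * eval e u"

primrec sat :: "(nat \<Rightarrow> 'a::{zero,one,plus,times,ord}) \<Rightarrow> fm \<Rightarrow> bool" where
  "sat e Fls = False"
| "sat e (t \<^bold>= u) = (eval e t = eval e u)"
| "sat e (t \<^bold>< u) = (eval e t < eval e u)"
| "sat e (p \<^bold>\<and> q) = (sat e p \<and> sat e q)"
| "sat e (p \<^bold>\<or> q) = (sat e p \<or> sat e q)"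
| "sat e (p \<^bold>\<longrightarrow> q) = (sat e p \<longrightarrow> sat e q)"
| "sat e (Forall p) = (\<forall>x. sat (case_nat x e) p)"
| "sat e (Exists p) = (\<exists>x. sat (case_nat x e) p)"

lemma eval_substt: "eval e (substt \<sigma> t) = eval (\<lambda>i. eval e (\<sigma> i)) t"
  by (induction t) auto

lemma eval_liftt [simp]: "eval e (liftt d t) = eval (\<lambda>i. e (i + d)) t"
  by (simp add: liftt_def eval_substt)

lemma eval_under: "(\<lambda>i. eval (case_nat x e) (under \<sigma> i)) = case_nat x (\<lambda>i. eval e (\<sigma> i))"
  by (auto simp: under_def fun_eq_iff split: nat.split)

lemma sat_subst: "sat e (subst \<sigma> p) = sat (\<lambda>i. eval e (\<sigma> i)) p"
  by (induction p arbitrary: e \<sigma>) (auto simp: eval_substt eval_under)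

lemma sat_lift: "sat e (lift d p) = sat (\<lambda>i. e (i + d)) p"
  by (simp add: lift_def sat_subst)

lemma sat_inst: "sat e (inst d ts p) =
    sat (\<lambda>i. if i < length ts then eval e (ts ! i) else e (i - length ts + d)) p"
  unfolding inst_def sat_subst by (rule arg_cong[where f = "\<lambda>e. sat e p"]) auto

lemma inst_single: "inst 0 [t] p = subst (case_nat t Var) p"
  unfolding inst_def by (rule arg_cong[where f = "\<lambda>\<sigma>. subst \<sigma> p"]) (auto split: nat.split)

lemma sat_inst_single: "sat e (inst 0 [t] p) = sat (case_nat (eval e t) e) p"
proof -
  have "(\<lambda>i. eval e (case_nat t Var i)) = case_nat (eval e t) e"
    by (auto split: nat.split)
  then show ?thesis
    by (simp add: inst_single sat_subst)
qed

lemma substt_substt: "substt \<sigma> (substt \<tau> t) = substt (\<lambda>i. substt \<sigma> (\<tau> i)) t"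
  by (induction t) auto

lemma substt_liftt: "substt (under \<sigma>) (liftt 1 t) = liftt 1 (substt \<sigma> t)"
  unfolding liftt_def substt_substt by (simp add: under_def liftt_def)

lemma under_comp: "(\<lambda>i. substt (under \<sigma>) (under \<tau> i)) = under (\<lambda>i. substt \<sigma> (\<tau> i))"
proof
  fix i show "substt (under \<sigma>) (under \<tau> i) = under (\<lambda>i. substt \<sigma> (\<tau> i)) i"
    by (cases i) (simp_all add: under_def[of \<tau>] under_def[of "\<lambda>i. substt \<sigma> (\<tau> i)"] substt_liftt
        del: One_nat_def, simp add: under_def)
qed

lemma subst_subst: "subst \<sigma> (subst \<tau> p) = subst (\<lambda>i. substt \<sigma> (\<tau> i)) p"
  by (induction p arbitrary: \<sigma> \<tau>) (auto simp: substt_substt under_comp)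

lemma substt_cong: "(\<And>i. i < fvt t \<Longrightarrow> \<sigma> i = \<tau> i) \<Longrightarrow> substt \<sigma> t = substt \<tau> t"
  by (induction t) auto

lemma subst_cong: "(\<And>i. i < fv p \<Longrightarrow> \<sigma> i = \<tau> i) \<Longrightarrow> subst \<sigma> p = subst \<tau> p"
proof (induction p arbitrary: \<sigma> \<tau>)
  case (Forall p)
  have "subst (under \<sigma>) p = subst (under \<tau>) p"
    using Forall.prems by (intro Forall.IH) (auto simp: under_def split: nat.split)
  then show ?case by simp
next
  case (Exists p)
  have "subst (under \<sigma>) p = subst (under \<tau>) p"
    using Exists.prems by (intro Exists.IH) (auto simp: under_def split: nat.split)
  then show ?case by simp
next
  case (Eq t u)
  then show ?case using substt_cong[of t \<sigma> \<tau>] substt_cong[of u \<sigma> \<tau>] by simp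
next
  case (Less t u)
  then show ?case using substt_cong[of t \<sigma> \<tau>] substt_cong[of u \<sigma> \<tau>] by simp
next
  case (Conj p q)
  have "subst \<sigma> p = subst \<tau> p" "subst \<sigma> q = subst \<tau> q"
    by (rule Conj.IH; use Conj.prems in simp)+
  then show ?case by simp
next
  case (Disj p q)
  have "subst \<sigma> p = subst \<tau> p" "subst \<sigma> q = subst \<tau> q"
    by (rule Disj.IH; use Disj.prems in simp)+
  then show ?case by simp
next
  case (Imp p q)
  have "subst \<sigma> p = subst \<tau> p" "subst \<sigma> q = subst \<tau> q"
    by (rule Imp.IH; use Imp.prems in simp)+
  then show ?case by simp
qed simp

lemma substt_Var: "substt Var t = t"
  by (induction t) auto

lemma under_Var: "under Var = Var"
  by (auto simp: under_def fun_eq_iff liftt_def split: nat.split)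

lemma subst_Var: "subst Var p = p"
  by (induction p) (auto simp: substt_Var under_Var)

lemma subst_closed: "fv p = 0 \<Longrightarrow> subst \<sigma> p = p"
  using subst_cong[of p \<sigma> Var] by (simp add: subst_Var)

lemma subst_lift: "subst (under \<sigma>) (lift 1 p) = lift 1 (subst \<sigma> p)"
  unfolding lift_def subst_subst
  by (rule arg_cong[where f = "\<lambda>\<sigma>. subst \<sigma> p"]) (simp add: under_def liftt_def)

lemma subst_inst: "subst \<sigma> (inst 0 [t] p) = inst 0 [substt \<sigma> t] (subst (under \<sigma>) p)"
proof -
  have "substt \<sigma> (case_nat t Var i) = substt (case_nat (substt \<sigma> t) Var) (under \<sigma> i)" for i
    by (auto simp: under_def liftt_def substt_substt substt_Var split: nat.split)
  then show ?thesis
    unfolding inst_single subst_subst by simp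
qed

section \<open>Completeness\<close>

lemma provable_mono: "\<Gamma> \<turnstile> p \<Longrightarrow> \<Gamma> \<subseteq> \<Delta> \<Longrightarrow> \<Delta> \<turnstile> p"
proof (induction arbitrary: \<Delta> rule: provable.induct)
  case (Boole p \<Gamma>)
  then show ?case by (meson insert_mono provable.Boole)
next
  case (ImpI p \<Gamma> q)
  then show ?case by (meson insert_mono provable.ImpI)
next
  case (DisjE \<Gamma> p q r)
  then show ?case by (meson insert_mono provable.DisjE)
next
  case (AllI \<Gamma> p)
  then show ?case by (meson image_mono provable.AllI)
next
  case (ExE \<Gamma> p q)
  then show ?case by (meson insert_mono image_mono provable.ExE)
next
  case (ExI \<Gamma> t p)
  then show ?case by (blast intro: provable.ExI)
next
  case (EqSubst \<Gamma> t u p)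
  then show ?case by (blast intro: provable.EqSubst)
next
  case (ImpE \<Gamma> p q)
  then show ?case by (blast intro: provable.ImpE)
next
  case (AllE \<Gamma> p t)
  then show ?case by (blast intro: provable.AllE)
qed (blast intro: provable.Assm provable.ConjI provable.ConjE1 provable.ConjE2
    provable.DisjI1 provable.DisjI2 provable.EqRefl)+

text \<open>\<open>consistent_witness\<close> uses this to turn a free variable into the
  eigenvariable 0 that \<open>ExE\<close> demands. The induction is over all \<sigma>, since the
  premises of the quantifier rules need \<open>under \<sigma>\<close>.\<close>

lemma provable_subst: "\<Gamma> \<turnstile> p \<Longrightarrow> subst \<sigma> ` \<Gamma> \<turnstile> subst \<sigma> p"
proof (induction arbitrary: \<sigma> rule: provable.induct)
  case (AllI \<Gamma> p)
  have "lift 1 ` subst \<sigma> ` \<Gamma> \<turnstile> subst (under \<sigma>) p"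
    using AllI.IH[of "under \<sigma>"] by (simp only: image_image subst_lift)
  then show ?case by (simp add: provable.AllI)
next
  case (AllE \<Gamma> p t)
  then show ?case using provable.AllE by (simp add: subst_inst)
next
  case (ExI \<Gamma> t p)
  then have "subst \<sigma> ` \<Gamma> \<turnstile> inst 0 [substt \<sigma> t] (subst (under \<sigma>) p)"
    by (simp add: subst_inst)
  then show ?case by (simp add: provable.ExI)
next
  case (ExE \<Gamma> p q)
  have "insert (subst (under \<sigma>) p) (lift 1 ` subst \<sigma> ` \<Gamma>) \<turnstile> lift 1 (subst \<sigma> q)"
    using ExE.IH(2)[of "under \<sigma>"] by (simp only: image_image image_insert subst_lift)
  then show ?case using ExE.IH(1)[of \<sigma>] by (auto intro: provable.ExE)
next
  case (EqSubst \<Gamma> t u p)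
  then show ?case
    using provable.EqSubst[of "subst \<sigma> ` \<Gamma>" "substt \<sigma> t" "substt \<sigma> u" "subst (under \<sigma>) p"]
    by (simp add: subst_inst)
next
  case (Boole p \<Gamma>)
  have "insert (Neg (subst \<sigma> p)) (subst \<sigma> ` \<Gamma>) \<turnstile> Fls"
    using Boole.IH[of \<sigma>] by simp
  then show ?case by (rule provable.Boole)
next
  case (ImpI p \<Gamma> q)
  then show ?case by (simp add: provable.ImpI)
next
  case (DisjE \<Gamma> p q r)
  then show ?case using provable.DisjE[of "subst \<sigma> ` \<Gamma>" "subst \<sigma> p" "subst \<sigma> q" "subst \<sigma> r"] by simp
next
  case (ImpE \<Gamma> p q)
  then show ?case by (metis provable.ImpE subst.simps(6))
qed (auto intro: provable.Assm provable.ConjI provable.ConjE1 provable.ConjE2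
    provable.DisjI1 provable.DisjI2 provable.EqRefl)

text \<open>Serves the rules that discharge a hypothesis \<open>p\<close>: whether or not the finite
  support contains \<open>p\<close>, it can be removed and put back by weakening.\<close>

lemma finite_support_insert:
  assumes "\<exists>\<Delta>. finite \<Delta> \<and> \<Delta> \<subseteq> insert p \<Gamma> \<and> (\<Delta> \<turnstile> q)"
  obtains \<Delta> where "finite \<Delta>" "\<Delta> \<subseteq> \<Gamma>" "insert p \<Delta> \<turnstile> q"
proof -
  from assms obtain \<Delta> where \<Delta>: "finite \<Delta>" "\<Delta> \<subseteq> insert p \<Gamma>" "\<Delta> \<turnstile> q"
    by blast
  have "insert p (\<Delta> - {p}) \<turnstile> q"
    by (rule provable_mono[OF \<Delta>(3)]) auto
  then show thesis
    using \<Delta> by (intro that[of "\<Delta> - {p}"]) auto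
qed

lemma provable_compact: "\<Gamma> \<turnstile> p \<Longrightarrow> \<exists>\<Delta>. finite \<Delta> \<and> \<Delta> \<subseteq> \<Gamma> \<and> (\<Delta> \<turnstile> p)"
proof (induction rule: provable.induct)
  case (Assm p \<Gamma>)
  then show ?case by (intro exI[of _ "{p}"]) (auto intro: provable.Assm)
next
  case (Boole p \<Gamma>)
  from Boole.IH obtain \<Delta> where \<Delta>: "finite \<Delta>" "\<Delta> \<subseteq> \<Gamma>" "insert (Neg p) \<Delta> \<turnstile> Fls"
    by (rule finite_support_insert)
  then show ?case using provable.Boole[OF \<Delta>(3)] by blast
next
  case (ImpI p \<Gamma> q)
  from ImpI.IH obtain \<Delta> where \<Delta>: "finite \<Delta>" "\<Delta> \<subseteq> \<Gamma>" "insert p \<Delta> \<turnstile> q"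
    by (rule finite_support_insert)
  then show ?case using provable.ImpI[OF \<Delta>(3)] by blast
next
  case (ImpE \<Gamma> p q)
  then obtain \<Delta> \<Delta>' where \<Delta>: "finite \<Delta>" "finite \<Delta>'" "\<Delta> \<subseteq> \<Gamma>" "\<Delta>' \<subseteq> \<Gamma>" "\<Delta> \<turnstile> p \<^bold>\<longrightarrow> q" "\<Delta>' \<turnstile> p"
    by blast
  have "\<Delta> \<union> \<Delta>' \<turnstile> q"
    by (rule provable.ImpE[of _ p]; rule provable_mono, rule \<Delta>, simp)
  then show ?case using \<Delta>(1-4) by (intro exI[of _ "\<Delta> \<union> \<Delta>'"]) simp
next
  case (ConjI \<Gamma> p q)
  then obtain \<Delta> \<Delta>' where \<Delta>: "finite \<Delta>" "finite \<Delta>'" "\<Delta> \<subseteq> \<Gamma>" "\<Delta>' \<subseteq> \<Gamma>" "\<Delta> \<turnstile> p" "\<Delta>' \<turnstile> q"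
    by blast
  have "\<Delta> \<union> \<Delta>' \<turnstile> p \<^bold>\<and> q"
    by (intro provable.ConjI provable_mono[OF \<Delta>(5)] provable_mono[OF \<Delta>(6)]) auto
  then show ?case using \<Delta>(1-4) by (intro exI[of _ "\<Delta> \<union> \<Delta>'"]) simp
next
  case (DisjE \<Gamma> p q r)
  from DisjE.IH(1) obtain \<Delta>1 where 1: "finite \<Delta>1" "\<Delta>1 \<subseteq> \<Gamma>" "\<Delta>1 \<turnstile> p \<^bold>\<or> q"
    by blast
  from DisjE.IH(2) obtain \<Delta>2 where 2: "finite \<Delta>2" "\<Delta>2 \<subseteq> \<Gamma>" "insert p \<Delta>2 \<turnstile> r"
    by (rule finite_support_insert)
  from DisjE.IH(3) obtain \<Delta>3 where 3: "finite \<Delta>3" "\<Delta>3 \<subseteq> \<Gamma>" "insert q \<Delta>3 \<turnstile> r"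
    by (rule finite_support_insert)
  let ?\<Delta> = "\<Delta>1 \<union> \<Delta>2 \<union> \<Delta>3"
  have "?\<Delta> \<turnstile> r"
  proof (rule provable.DisjE)
    show "?\<Delta> \<turnstile> p \<^bold>\<or> q" using 1(3) by (rule provable_mono) auto
    show "insert p ?\<Delta> \<turnstile> r" using 2(3) by (rule provable_mono) auto
    show "insert q ?\<Delta> \<turnstile> r" using 3(3) by (rule provable_mono) auto
  qed
  then show ?case using 1 2 3 by (intro exI[of _ ?\<Delta>]) auto
next
  case (AllI \<Gamma> p)
  then obtain \<Delta> where "finite \<Delta>" "\<Delta> \<subseteq> lift 1 ` \<Gamma>" and p: "\<Delta> \<turnstile> p"
    by blast
  then obtain \<Delta>' where \<Delta>': "\<Delta>' \<subseteq> \<Gamma>" "finite \<Delta>'" "\<Delta> = lift 1 ` \<Delta>'"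
    by (auto dest: finite_subset_image)
  then have "\<Delta>' \<turnstile> Forall p" using provable.AllI p by simp
  then show ?case using \<Delta>' by blast
next
  case (ExE \<Gamma> p q)
  from ExE.IH(1) obtain \<Delta>1 where 1: "finite \<Delta>1" "\<Delta>1 \<subseteq> \<Gamma>" "\<Delta>1 \<turnstile> Exists p"
    by blast
  from ExE.IH(2) obtain \<Delta>2 where 2: "finite \<Delta>2" "\<Delta>2 \<subseteq> lift 1 ` \<Gamma>" "insert p \<Delta>2 \<turnstile> lift 1 q"
    by (rule finite_support_insert)
  from 2(1,2) obtain \<Delta>3 where 3: "finite \<Delta>3" "\<Delta>3 \<subseteq> \<Gamma>" "\<Delta>2 = lift 1 ` \<Delta>3"
    by (auto dest: finite_subset_image)
  let ?\<Delta> = "\<Delta>1 \<union> \<Delta>3"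
  have "?\<Delta> \<turnstile> q"
  proof (rule provable.ExE)
    show "?\<Delta> \<turnstile> Exists p" using 1(3) by (rule provable_mono) auto
    show "insert p (lift 1 ` ?\<Delta>) \<turnstile> lift 1 q" using 2(3) by (rule provable_mono) (auto simp: 3(3))
  qed
  then show ?case using 1 3 by (intro exI[of _ ?\<Delta>]) auto
next
  case (EqRefl \<Gamma> t)
  then show ?case by (intro exI[of _ "{}"]) (auto intro: provable.EqRefl)
next
  case (EqSubst \<Gamma> t u p)
  then obtain \<Delta> \<Delta>' where \<Delta>: "finite \<Delta>" "finite \<Delta>'" "\<Delta> \<subseteq> \<Gamma>" "\<Delta>' \<subseteq> \<Gamma>"
      "\<Delta> \<turnstile> t \<^bold>= u" "\<Delta>' \<turnstile> inst 0 [t] p"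
    by blast
  have "\<Delta> \<union> \<Delta>' \<turnstile> inst 0 [u] p"
    by (rule provable.EqSubst[of _ t]; rule provable_mono, rule \<Delta>, simp)
  then show ?case using \<Delta>(1-4) by (intro exI[of _ "\<Delta> \<union> \<Delta>'"]) simp
qed (blast intro: provable.ConjE1 provable.ConjE2 provable.DisjI1 provable.DisjI2
    provable.AllE provable.ExI)+

text \<open>Serves to show \<open>ISigma1\<close> consistent by way of the standard numbers.\<close>

lemma soundness: "\<Gamma> \<turnstile> p \<Longrightarrow> (\<And>q. q \<in> \<Gamma> \<Longrightarrow> sat e q) \<Longrightarrow> sat e p"
proof (induction arbitrary: e rule: provable.induct)
  case (Boole p \<Gamma>)
  show ?case
  proof (rule ccontr)
    assume "\<not> sat e p"
    then have "sat e Fls" using Boole.prems by (intro Boole.IH) auto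
    then show False by simp
  qed
next
  case (AllI \<Gamma> p)
  have "sat (case_nat x e) p" for x
    using AllI.prems by (intro AllI.IH) (auto simp: sat_lift)
  then show ?case by simp
next
  case (ExE \<Gamma> p q)
  have "sat e (Exists p)"
    using ExE.prems by (rule ExE.IH(1))
  then obtain x where "sat (case_nat x e) p"
    by auto
  then have "sat (case_nat x e) (lift 1 q)"
    using ExE.prems by (intro ExE.IH(2)) (auto simp: sat_lift)
  then show ?case by (simp add: sat_lift)
next
  case (EqSubst \<Gamma> t u p)
  then show ?case using EqSubst.IH(1)[of e] EqSubst.IH(2)[of e] by (simp add: sat_inst_single)
next
  case (DisjE \<Gamma> p q r)
  have "sat e (p \<^bold>\<or> q)"
    using DisjE.prems by (rule DisjE.IH(1))
  then show ?case
    using DisjE.IH(2)[of e] DisjE.IH(3)[of e] DisjE.prems by auto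
qed (auto simp: sat_inst_single)

definition consistent :: "fm set \<Rightarrow> bool" where
  "consistent \<Gamma> \<longleftrightarrow> \<not> (\<Gamma> \<turnstile> Fls)"

definition henkin :: "fm set \<Rightarrow> bool" where
  "henkin H \<longleftrightarrow> consistent H \<and> (\<forall>p. p \<in> H \<or> Neg p \<in> H) \<and>
     (\<forall>p. Exists p \<in> H \<longrightarrow> (\<exists>t. inst 0 [t] p \<in> H))"

lemma provable_contradiction: "Neg p \<in> \<Gamma> \<Longrightarrow> insert p \<Gamma> \<turnstile> Fls"
  by (rule provable.ImpE[of _ p]; rule provable.Assm; simp)

lemma consistent_insert_Neg:
  assumes "consistent \<Gamma>" "\<not> consistent (insert p \<Gamma>)"
  shows "consistent (insert (Neg p) \<Gamma>)"
  using assms provable.Boole provable.ImpE provable.ImpI unfolding consistent_def by blast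

text \<open>A variable that is free neither in the context nor in \<open>p\<close> serves as Henkin constant.\<close>

lemma consistent_witness:
  assumes closed: "\<And>q. q \<in> \<Gamma> \<Longrightarrow> fv q = 0" and fin: "finite \<Delta>"
    and con: "consistent (\<Gamma> \<union> \<Delta>)" and ex: "Exists p \<in> \<Delta>"
  shows "\<exists>c. consistent (insert (inst 0 [Var c] p) (\<Gamma> \<union> \<Delta>))"
proof -
  obtain c where c: "\<And>q. q \<in> \<Delta> \<Longrightarrow> fv q \<le> c"
    using fin by (meson finite_imageI finite_nat_set_iff_bounded_le imageI)
  \<comment> \<open>On formulas in which \<open>Var c\<close> is not free, \<sigma> acts as
    \<open>lift 1\<close>, while the witness \<open>Var c\<close> becomes the bound variable 0.
    Renaming a refutation by \<sigma> thus gives exactly the second premise of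
    \<open>ExE\<close>.\<close>
  define \<sigma> where "\<sigma> i = (if i = c then Var 0 else Var (Suc i))" for i
  have \<sigma>: "subst \<sigma> q = lift 1 q" if "q \<in> \<Gamma> \<union> \<Delta>" for q
  proof -
    have "fv q \<le> c" using that c closed by force
    then show ?thesis unfolding lift_def by (intro subst_cong) (auto simp: \<sigma>_def)
  qed
  have "fv p \<le> Suc c" using c[OF ex] by simp
  then have \<sigma>p: "subst \<sigma> (inst 0 [Var c] p) = p"
    unfolding inst_single subst_subst using subst_cong[of p _ Var]
    by (subst subst_cong[of p _ Var]) (auto simp: subst_Var \<sigma>_def split: nat.split)
  have "\<Gamma> \<union> \<Delta> \<turnstile> Fls" if "insert (inst 0 [Var c] p) (\<Gamma> \<union> \<Delta>) \<turnstile> Fls"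
  proof (rule provable.ExE)
    show "\<Gamma> \<union> \<Delta> \<turnstile> Exists p" using ex by (simp add: provable.Assm)
    have "subst \<sigma> ` (\<Gamma> \<union> \<Delta>) = lift 1 ` (\<Gamma> \<union> \<Delta>)"
      using \<sigma> by (intro image_cong) auto
    then show "insert p (lift 1 ` (\<Gamma> \<union> \<Delta>)) \<turnstile> lift 1 Fls"
      using provable_subst[OF that, of \<sigma>] by (simp add: \<sigma>p lift_def)
  qed
  then show ?thesis using con unfolding consistent_def by blast
qed

lemma consistent_step:
  assumes closed: "\<And>q. q \<in> \<Gamma> \<Longrightarrow> fv q = 0" and fin: "finite \<Delta>"
    and con: "consistent (\<Gamma> \<union> \<Delta>)"
  shows "\<exists>\<Delta>'. finite \<Delta>' \<and> consistent (\<Gamma> \<union> \<Delta>') \<and> \<Delta> \<subseteq> \<Delta>' \<and> (p \<in> \<Delta>' \<or> Neg p \<in> \<Delta>') \<and>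
    (\<forall>q. p = Exists q \<longrightarrow> p \<in> \<Delta>' \<longrightarrow> (\<exists>t. inst 0 [t] q \<in> \<Delta>'))"
proof (cases "consistent (\<Gamma> \<union> insert p \<Delta>)")
  case True
  show ?thesis
  proof (cases "\<exists>q. p = Exists q")
    case True
    then obtain q where q: "p = Exists q" by blast
    obtain c where "consistent (insert (inst 0 [Var c] q) (\<Gamma> \<union> insert p \<Delta>))"
      using consistent_witness[of \<Gamma> "insert p \<Delta>" q] closed fin \<open>consistent (\<Gamma> \<union> insert p \<Delta>)\<close> q
      by blast
    then show ?thesis
      using fin q by (intro exI[of _ "insert (inst 0 [Var c] q) (insert p \<Delta>)"]) auto
  next
    case False
    then show ?thesis using fin \<open>consistent (\<Gamma> \<union> insert p \<Delta>)\<close>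
      by (intro exI[of _ "insert p \<Delta>"]) auto
  qed
next
  case False
  then have "consistent (\<Gamma> \<union> insert (Neg p) \<Delta>)"
    using consistent_insert_Neg[OF con, of p] by simp
  \<comment> \<open>This makes the witness clause vacuous when the negation has been chosen.\<close>
  moreover have "p \<notin> insert (Neg p) \<Delta>"
    using False con by (metis Un_insert_right insert_absorb insert_iff fm.distinct(29)
        calculation consistent_def provable.Assm provable.ImpE insertI1 UnI2)
  ultimately show ?thesis
    using fin by (intro exI[of _ "insert (Neg p) \<Delta>"]) auto
qed

text \<open>The formulas are decided one by one along their enumeration. The given theory is closed
  and only finitely many formulas have been added at any stage, so a fresh variable is always left
  as a witness. Compactness carries consistency over to the union.\<close>

theorem henkin_extension:
  assumes closed: "\<And>q. q \<in> \<Gamma> \<Longrightarrow> fv q = 0" and con: "consistent \<Gamma>"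
  shows "\<exists>H. henkin H \<and> \<Gamma> \<subseteq> H"
proof -
  have "\<exists>f. \<forall>n. (finite (f n) \<and> consistent (\<Gamma> \<union> f n)) \<and>
    (f n \<subseteq> f (Suc n) \<and> (from_nat n \<in> f (Suc n) \<or> Neg (from_nat n) \<in> f (Suc n)) \<and>
     (\<forall>q. from_nat n = Exists q \<longrightarrow> from_nat n \<in> f (Suc n) \<longrightarrow> (\<exists>t. inst 0 [t] q \<in> f (Suc n))))"
  proof (rule dependent_nat_choice)
    show "\<exists>\<Delta>. finite \<Delta> \<and> consistent (\<Gamma> \<union> \<Delta>)"
      using con by (intro exI[of _ "{}"]) simp
  next
    fix \<Delta> :: "fm set" and n :: nat
    assume "finite \<Delta> \<and> consistent (\<Gamma> \<union> \<Delta>)"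
    then show "\<exists>\<Delta>'. (finite \<Delta>' \<and> consistent (\<Gamma> \<union> \<Delta>')) \<and> \<Delta> \<subseteq> \<Delta>' \<and>
        (from_nat n \<in> \<Delta>' \<or> Neg (from_nat n) \<in> \<Delta>') \<and>
        (\<forall>q. from_nat n = Exists q \<longrightarrow> from_nat n \<in> \<Delta>' \<longrightarrow> (\<exists>t. inst 0 [t] q \<in> \<Delta>'))"
      using consistent_step[of \<Gamma> \<Delta> "from_nat n"] closed by (elim conjE) (simp add: conj_assoc)
  qed
  then obtain f where con_f: "\<And>n. consistent (\<Gamma> \<union> f n)" and mono_f: "\<And>n. f n \<subseteq> f (Suc n)"
    and dec: "\<And>n. from_nat n \<in> f (Suc n) \<or> Neg (from_nat n) \<in> f (Suc n)"
    and wit: "\<And>n q. from_nat n = Exists q \<Longrightarrow> from_nat n \<in> f (Suc n) \<Longrightarrow> \<exists>t. inst 0 [t] q \<in> f (Suc n)"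
    by blast
  define H where "H = \<Gamma> \<union> (\<Union>n. f n)"
  have mono: "f m \<subseteq> f n" if "m \<le> n" for m n
    using that mono_f by (rule lift_Suc_mono_le[rotated])
  have "\<exists>n. \<Delta> \<subseteq> \<Gamma> \<union> f n" if "finite \<Delta>" "\<Delta> \<subseteq> H" for \<Delta>
    using that
  proof (induction \<Delta> rule: finite_induct)
    case (insert q \<Delta>)
    then obtain m n where "\<Delta> \<subseteq> \<Gamma> \<union> f n" "q \<in> \<Gamma> \<union> f m" unfolding H_def by auto
    then show ?case using mono[of m "max m n"] mono[of n "max m n"]
      by (intro exI[of _ "max m n"]) auto
  qed simp
  then have "consistent H"
    using con_f provable_compact provable_mono unfolding consistent_def by meson
  moreover have dec_H: "p \<in> H \<or> Neg p \<in> H" for p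
    using dec[of "to_nat p"] by (auto simp: H_def)
  moreover have "\<exists>t. inst 0 [t] q \<in> H" if "Exists q \<in> H" for q
  proof -
    let ?n = "to_nat (Exists q)"
    \<comment> \<open>The stage that decided \<open>Exists q\<close> must therefore have accepted
      it, and it added a witness at the same time.\<close>
    have "Neg (Exists q) \<notin> f (Suc ?n)"
      using that \<open>consistent H\<close> unfolding consistent_def
      by (metis H_def UN_I UNIV_I UnI2 provable.Assm provable.ImpE)
    then show ?thesis using dec[of ?n] wit[of ?n q] by (auto simp: H_def)
  qed
  ultimately show ?thesis
    unfolding henkin_def by (intro exI[of _ H]) (auto simp: H_def)
qed

lemma inst_lift_Var: "inst 0 [Var 0] (subst (under (\<lambda>i. Var (i + 1))) p) = p"
proof -
  have "substt (case_nat (Var 0) Var) (under (\<lambda>i. Var (i + 1)) i) = Var i" for i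
    by (cases i) (simp_all add: under_def liftt_def)
  then show ?thesis unfolding inst_single subst_subst by (simp add: subst_Var)
qed

text \<open>Witnesses are provided for existential formulas only; this classical law turns a
  rejected universal formula into one, so that a counterexample term is found in
  \<open>henkin_Forall\<close>.\<close>

lemma provable_not_Forall: "insert (Neg (Forall p)) \<Gamma> \<turnstile> Exists (Neg p)"
proof (rule provable.Boole, rule provable.ImpE)
  let ?\<Gamma> = "insert (Neg (Exists (Neg p))) (insert (Neg (Forall p)) \<Gamma>)"
  show "?\<Gamma> \<turnstile> Neg (Forall p)" by (simp add: provable.Assm)
  show "?\<Gamma> \<turnstile> Forall p"
  proof (rule provable.AllI, rule provable.Boole, rule provable.ImpE)
    let ?\<Delta> = "insert (Neg p) (lift 1 ` ?\<Gamma>)"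
    show "?\<Delta> \<turnstile> Neg (lift 1 (Exists (Neg p)))"
      by (rule provable.Assm) (simp add: lift_def)
    have "?\<Delta> \<turnstile> inst 0 [Var 0] (subst (under (\<lambda>i. Var (i + 1))) (Neg p))"
      unfolding inst_lift_Var by (simp add: provable.Assm)
    then show "?\<Delta> \<turnstile> lift 1 (Exists (Neg p))"
      unfolding lift_def subst.simps(8) by (rule provable.ExI)
  qed
qed

section \<open>Membership in a Henkin set commutes with connectives and quantifiers\<close>

context
  fixes H assumes H: "henkin H"
begin

lemma henkin_provable: "(H \<turnstile> p) \<longleftrightarrow> p \<in> H"
  using H provable.Assm provable.ImpE unfolding henkin_def consistent_def by blast

lemma henkin_Fls: "Fls \<notin> H"
  using H henkin_provable unfolding henkin_def consistent_def by blast

lemma henkin_Neg: "Neg p \<in> H \<longleftrightarrow> p \<notin> H"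
  using H henkin_Fls henkin_provable provable.ImpE unfolding henkin_def by blast

lemma henkin_Conj: "(p \<^bold>\<and> q) \<in> H \<longleftrightarrow> p \<in> H \<and> q \<in> H"
  using henkin_provable provable.ConjI provable.ConjE1 provable.ConjE2 by blast

lemma henkin_Imp: "(p \<^bold>\<longrightarrow> q) \<in> H \<longleftrightarrow> (p \<in> H \<longrightarrow> q \<in> H)"
proof -
  have "(p \<^bold>\<longrightarrow> q) \<in> H" if "q \<in> H"
    unfolding henkin_provable[symmetric] using that by (intro provable.ImpI provable.Assm) simp
  moreover have "(p \<^bold>\<longrightarrow> q) \<in> H" if "Neg p \<in> H"
  proof -
    have "insert p H \<turnstile> Fls"
      using that by (simp add: provable_contradiction)
    then have "insert (Neg q) (insert p H) \<turnstile> Fls"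
      by (rule provable_mono) auto
    then show ?thesis
      unfolding henkin_provable[symmetric] by (rule provable.Boole[THEN provable.ImpI])
  qed
  moreover have "q \<in> H" if "(p \<^bold>\<longrightarrow> q) \<in> H" "p \<in> H"
    using provable.ImpE[of H p q] that by (simp only: henkin_provable)
  ultimately show ?thesis using henkin_Neg by blast
qed

lemma henkin_Disj: "(p \<^bold>\<or> q) \<in> H \<longleftrightarrow> p \<in> H \<or> q \<in> H"
proof
  assume "(p \<^bold>\<or> q) \<in> H"
  then have *: "H \<turnstile> p \<^bold>\<or> q" by (rule provable.Assm)
  show "p \<in> H \<or> q \<in> H"
  proof (rule ccontr)
    assume "\<not> (p \<in> H \<or> q \<in> H)"
    then have "Neg p \<in> H" "Neg q \<in> H" using henkin_Neg by auto
    then have "insert p H \<turnstile> Fls" "insert q H \<turnstile> Fls"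
      by (simp_all add: provable_contradiction)
    then have "H \<turnstile> Fls" by (rule provable.DisjE[OF *])
    then show False using henkin_provable henkin_Fls by simp
  qed
next
  assume "p \<in> H \<or> q \<in> H"
  then show "(p \<^bold>\<or> q) \<in> H"
    using provable.DisjI1[of H p q] provable.DisjI2[of H q p] by (simp only: henkin_provable) blast
qed

lemma henkin_Exists: "Exists p \<in> H \<longleftrightarrow> (\<exists>t. inst 0 [t] p \<in> H)"
  using H henkin_provable provable.ExI unfolding henkin_def by blast

lemma henkin_Forall: "Forall p \<in> H \<longleftrightarrow> (\<forall>t. inst 0 [t] p \<in> H)"
proof
  show "\<forall>t. inst 0 [t] p \<in> H" if "Forall p \<in> H"
    using that henkin_provable provable.AllE by blast
next
  assume all: "\<forall>t. inst 0 [t] p \<in> H"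
  show "Forall p \<in> H"
  proof (rule ccontr)
    assume "Forall p \<notin> H"
    then have "insert (Neg (Forall p)) H = H" using henkin_Neg by blast
    then have "Exists (Neg p) \<in> H" using provable_not_Forall[of p H] henkin_provable by simp
    then show False using all henkin_Exists henkin_Neg by (auto simp: inst_def)
  qed
qed

lemma henkin_refl: "(t \<^bold>= t) \<in> H"
  using henkin_provable provable.EqRefl by blast

lemma henkin_subst: "(t \<^bold>= u) \<in> H \<Longrightarrow> inst 0 [t] p \<in> H \<Longrightarrow> inst 0 [u] p \<in> H"
  using henkin_provable provable.EqSubst by blast

end

section \<open>Equality in a Henkin set is a congruence\<close>

lemma substt_case_liftt: "substt (case_nat t Var) (liftt (Suc 0) v) = v"
  by (simp add: liftt_def substt_substt substt_Var)

context
  fixes H assumes H: "henkin H"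
begin

text \<open>This and the following laws apply \<open>EqSubst\<close> to a template in which
  \<open>Var 0\<close> marks the place of replacement and all other terms are lifted past
  it.\<close>

lemma henkin_sym: "(t \<^bold>= u) \<in> H \<Longrightarrow> (u \<^bold>= t) \<in> H"
  using henkin_subst[OF H, of t u "Var 0 \<^bold>= liftt 1 t"] henkin_refl[OF H]
  by (simp add: inst_single substt_case_liftt)

lemma henkin_trans: "(t \<^bold>= u) \<in> H \<Longrightarrow> (u \<^bold>= v) \<in> H \<Longrightarrow> (t \<^bold>= v) \<in> H"
  using henkin_subst[OF H, of u v "liftt 1 t \<^bold>= Var 0"]
  by (simp add: inst_single substt_case_liftt)

lemma henkin_Succ: "(t \<^bold>= u) \<in> H \<Longrightarrow> (Succ t \<^bold>= Succ u) \<in> H"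
  using henkin_subst[OF H, of t u "Succ (liftt 1 t) \<^bold>= Succ (Var 0)"] henkin_refl[OF H]
  by (simp add: inst_single substt_case_liftt)

lemma henkin_Add: "(t \<^bold>= u) \<in> H \<Longrightarrow> (t' \<^bold>= u') \<in> H \<Longrightarrow> (t \<^bold>+ t' \<^bold>= u \<^bold>+ u') \<in> H"
  using henkin_subst[OF H, of t u "liftt 1 (t \<^bold>+ t') \<^bold>= Var 0 \<^bold>+ liftt 1 t'"]
    henkin_subst[OF H, of t' u' "liftt 1 (t \<^bold>+ t') \<^bold>= liftt 1 u \<^bold>+ Var 0"] henkin_refl[OF H]
  by (simp add: inst_single substt_case_liftt)

lemma henkin_Mul: "(t \<^bold>= u) \<in> H \<Longrightarrow> (t' \<^bold>= u') \<in> H \<Longrightarrow> (t \<^bold>* t' \<^bold>= u \<^bold>* u') \<in> H"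
  using henkin_subst[OF H, of t u "liftt 1 (t \<^bold>* t') \<^bold>= Var 0 \<^bold>* liftt 1 t'"]
    henkin_subst[OF H, of t' u' "liftt 1 (t \<^bold>* t') \<^bold>= liftt 1 u \<^bold>* Var 0"] henkin_refl[OF H]
  by (simp add: inst_single substt_case_liftt)

lemma henkin_Less:
  assumes "(t \<^bold>= u) \<in> H" "(t' \<^bold>= u') \<in> H" "(t \<^bold>< t') \<in> H"
  shows "(u \<^bold>< u') \<in> H"
  using henkin_subst[OF H assms(1), of "Var 0 \<^bold>< liftt 1 t'"]
    henkin_subst[OF H assms(2), of "liftt 1 u \<^bold>< Var 0"] assms(3)
  by (simp add: inst_single substt_case_liftt)

end

section \<open>The model\<close>

lemma sat_inst_1: "sat (case_nat x e) (inst (Suc 0) [t] p) = sat (case_nat (eval (case_nat x e) t) e) p"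
  unfolding sat_inst by (rule arg_cong[where f = "\<lambda>e. sat e p"]) (auto split: nat.split)

lemma fv_Foralls: "fv ((Forall ^^ n) p) = fv p - n"
  by (induction n) auto

lemma fv_ucl: "fv (ucl p) = 0"
  by (simp add: ucl_def fv_Foralls)

lemma sat_ucl:
  fixes e :: "nat \<Rightarrow> 'a::{zero,one,plus,times,ord}"
  assumes "\<And>e :: nat \<Rightarrow> 'a. sat e p"
  shows "sat e (ucl p)"
proof -
  have "sat e ((Forall ^^ n) p)" for n and e :: "nat \<Rightarrow> 'a"
    using assms by (induction n arbitrary: e) auto
  then show ?thesis by (simp add: ucl_def)
qed

abbreviation (input) totality :: fm where
  "totality \<equiv> Forall (Forall (Exists (phi_A (Var 2) (Var 1) (Var 0))))"

lemma ISigma1_closed: "p \<in> ISigma1 \<Longrightarrow> fv p = 0"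
  by (auto simp: ISigma1_def PA_basic_def fv_ucl)

lemma PSigma1_closed: "p \<in> PSigma1 \<Longrightarrow> fv p = 0"
  by (auto simp: PSigma1_def ISigma1_closed fv_ucl)

lemma totality_closed: "fv totality = 0"
  by (simp add: phi_A_def ack_comp_def before_def entry_def lth_def ball_def bex_def
      triple_def pair_def liftt_def)

lemma nat_sat_ISigma1:
  assumes "p \<in> ISigma1"
  shows "sat (e :: nat \<Rightarrow> nat) p"
proof -
  consider q where "p = ucl q" "q \<in> {Neg (Succ (Var 0) \<^bold>= Zero),
     Succ (Var 0) \<^bold>= Succ (Var 1) \<^bold>\<longrightarrow> Var 0 \<^bold>= Var 1,
     Var 0 \<^bold>+ Zero \<^bold>= Var 0,
     Var 0 \<^bold>+ Succ (Var 1) \<^bold>= Succ (Var 0 \<^bold>+ Var 1),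
     Var 0 \<^bold>* Zero \<^bold>= Zero,
     Var 0 \<^bold>* Succ (Var 1) \<^bold>= Var 0 \<^bold>* Var 1 \<^bold>+ Var 0,
     Neg (Var 0 \<^bold>< Zero),
     Iff (Var 0 \<^bold>< Succ (Var 1)) (Var 0 \<^bold>< Var 1 \<^bold>\<or> Var 0 \<^bold>= Var 1)}"
    | q where "p = ucl (induction_ax q)"
    using assms by (auto simp: ISigma1_def PA_basic_def)
  then show ?thesis
  proof cases
    case 1
    then have "sat e q" for e :: "nat \<Rightarrow> nat" by auto
    then show ?thesis unfolding 1(1) by (rule sat_ucl)
  next
    case 2
    have "sat e (induction_ax q)" for e :: "nat \<Rightarrow> nat"
    proof -
      have "sat (case_nat x e) q"
        if "sat (case_nat 0 e) q" "\<And>x. sat (case_nat x e) q \<Longrightarrow> sat (case_nat x e) (inst 1 [Succ (Var 0)] q)" for x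
        using that(1) by (induction x) (use that(2) in \<open>auto simp: sat_inst_1\<close>)
      then show ?thesis by (simp add: induction_ax_def sat_inst_single)
    qed
    then show ?thesis unfolding 2 by (rule sat_ucl)
  qed
qed

lemma ISigma1_consistent: "consistent ISigma1"
  unfolding consistent_def using soundness[of ISigma1 Fls "\<lambda>_. 0 :: nat"] nat_sat_ISigma1 by auto

text \<open>
  A type cannot be defined under the assumption that \<^term>\<open>PSigma1\<close> does not prove totality.
  The fallback \<^term>\<open>ISigma1\<close> makes the definition of the type of numbers of the model unconditional.
\<close>

definition base_theory :: "fm set" where
  "base_theory = (if consistent (insert (Neg totality) PSigma1) then insert (Neg totality) PSigma1
     else ISigma1)"

definition completion :: "fm set" where
  "completion = (SOME H. henkin H \<and> base_theory \<subseteq> H)"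

lemma completion: "henkin completion" "base_theory \<subseteq> completion"
proof -
  have "\<exists>H. henkin H \<and> base_theory \<subseteq> H"
  proof (rule henkin_extension)
    fix q assume "q \<in> base_theory"
    then have "q = Neg totality \<or> q \<in> PSigma1 \<or> q \<in> ISigma1"
      unfolding base_theory_def by (metis insert_iff)
    then show "fv q = 0"
      using ISigma1_closed PSigma1_closed totality_closed by (metis fv.simps(1,6) max.idem)
  next
    show "consistent base_theory"
      unfolding base_theory_def by (simp only: ISigma1_consistent split: if_split) blast
  qed
  then have "henkin completion \<and> base_theory \<subseteq> completion"
    unfolding completion_def by (rule someI_ex)
  then show "henkin completion" "base_theory \<subseteq> completion" by auto
qed

lemma ISigma1_completion: "p \<in> ISigma1 \<Longrightarrow> p \<in> completion"
  using completion(2) unfolding base_theory_def PSigma1_def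
  by (cases "consistent (insert (Neg totality) PSigma1)") (auto simp: PSigma1_def)

lemma subst_case_nat: "inst 0 [t] (subst (under \<sigma>) p) = subst (case_nat t \<sigma>) p"
proof -
  have "substt (case_nat t Var) (under \<sigma> i) = case_nat t \<sigma> i" for i
    by (cases i) (simp_all add: under_def substt_case_liftt)
  then show ?thesis by (simp add: inst_single subst_subst)
qed

text \<open>The substitution instantiates all quantifiers together: the innermost one receives
  \<open>\<sigma> 0\<close>, the outer ones the shifted substitution. Peeling from the inside is why
  the induction passes from \<open>p\<close> to \<open>Forall p\<close>.\<close>

lemma subst_Foralls:
  assumes "\<And>\<sigma>. subst \<sigma> ((Forall ^^ n) p) \<in> completion"
  shows "subst \<sigma> p \<in> completion"
  using assms
proof (induction n arbitrary: \<sigma> p)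
  case (Suc n)
  have "subst (\<lambda>i. \<sigma> (Suc i)) (Forall p) \<in> completion"
    by (rule Suc.IH) (use Suc.prems in \<open>simp only: funpow_Suc_right o_apply\<close>)
  then have "inst 0 [\<sigma> 0] (subst (under (\<lambda>i. \<sigma> (Suc i))) p) \<in> completion"
    using henkin_Forall[OF completion(1)] by simp
  moreover have "case_nat (\<sigma> 0) (\<lambda>i. \<sigma> (Suc i)) = \<sigma>"
    by (auto split: nat.split)
  ultimately show ?case by (simp add: subst_case_nat)
qed (simp add: subst_Var)

lemma ucl_completion: "ucl p \<in> completion \<Longrightarrow> subst \<sigma> p \<in> completion"
  by (rule subst_Foralls[of "fv p"]) (metis fv_ucl subst_closed ucl_def)

text \<open>The recursion equations for addition give t + S0 = S(t + 0) = St.\<close>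

lemma Succ_completion: "(t \<^bold>+ Succ Zero \<^bold>= Succ t) \<in> completion"
proof -
  have "subst (case_nat t (\<lambda>_. Zero)) (Var 0 \<^bold>+ Zero \<^bold>= Var 0) \<in> completion"
    "subst (case_nat t (\<lambda>_. Zero)) (Var 0 \<^bold>+ Succ (Var 1) \<^bold>= Succ (Var 0 \<^bold>+ Var 1)) \<in> completion"
    by (intro ucl_completion ISigma1_completion; simp add: ISigma1_def PA_basic_def)+
  then show ?thesis
    using henkin_trans[OF completion(1)] henkin_Succ[OF completion(1)] by fastforce
qed

\<comment> \<open>The term model. Terms may contain free variables, which act as constants, so every
  element has a name and quantifiers over the model become quantifiers over terms.\<close>
quotient_type mnat = tm / "\<lambda>t u. (t \<^bold>= u) \<in> completion"
proof (rule equivpI)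
  show "reflp (\<lambda>t u. (t \<^bold>= u) \<in> completion)"
    using henkin_refl[OF completion(1)] by (simp add: reflp_def)
  show "symp (\<lambda>t u. (t \<^bold>= u) \<in> completion)"
    using henkin_sym[OF completion(1)] by (blast intro: sympI)
  show "transp (\<lambda>t u. (t \<^bold>= u) \<in> completion)"
    using henkin_trans[OF completion(1)] by (blast intro: transpI)
qed

instantiation mnat :: "{zero,one,plus,times,ord}"
begin

lift_definition zero_mnat :: mnat is Zero .
lift_definition one_mnat :: mnat is "Succ Zero" .
lift_definition plus_mnat :: "mnat \<Rightarrow> mnat \<Rightarrow> mnat" is "(\<^bold>+)"
  by (rule henkin_Add[OF completion(1)])
lift_definition times_mnat :: "mnat \<Rightarrow> mnat \<Rightarrow> mnat" is "(\<^bold>*)"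
  by (rule henkin_Mul[OF completion(1)])
lift_definition less_mnat :: "mnat \<Rightarrow> mnat \<Rightarrow> bool" is "\<lambda>t u. (t \<^bold>< u) \<in> completion"
  using henkin_Less[OF completion(1)] henkin_sym[OF completion(1)] by blast
definition less_eq_mnat :: "mnat \<Rightarrow> mnat \<Rightarrow> bool" where
  "less_eq_mnat x y \<longleftrightarrow> x < y \<or> x = y"

instance ..

end

lemma abs_mnat_Succ: "abs_mnat (Succ t) = abs_mnat t + 1"
  unfolding one_mnat.abs_eq plus_mnat.abs_eq mnat.abs_eq_iff
  by (rule henkin_sym[OF completion(1) Succ_completion])

lemma eval_abs_mnat: "eval (\<lambda>i. abs_mnat (\<sigma> i)) t = abs_mnat (substt \<sigma> t)"
  by (induction t) (simp_all add: zero_mnat.abs_eq abs_mnat_Succ plus_mnat.abs_eq times_mnat.abs_eq)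

lemma mnat_exhaust: obtains t where "x = abs_mnat t"
  by (metis Quotient3_abs_rep Quotient3_mnat)

lemma case_nat_abs_mnat: "case_nat (abs_mnat t) (\<lambda>i. abs_mnat (\<sigma> i)) = (\<lambda>i. abs_mnat (case_nat t \<sigma> i))"
  by (auto split: nat.split)

text \<open>The truth lemma: an environment in the term model is represented by a substitution, and
  extending the one at a quantifier amounts to extending the other.\<close>

lemma truth: "sat (\<lambda>i. abs_mnat (\<sigma> i)) p \<longleftrightarrow> subst \<sigma> p \<in> completion"
proof (induction p arbitrary: \<sigma>)
  case (Forall p)
  have "sat (\<lambda>i. abs_mnat (\<sigma> i)) (Forall p) \<longleftrightarrow> (\<forall>t. sat (case_nat (abs_mnat t) (\<lambda>i. abs_mnat (\<sigma> i))) p)"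
    by (metis mnat_exhaust sat.simps(7))
  then show ?case
    by (simp add: case_nat_abs_mnat Forall.IH henkin_Forall[OF completion(1)] subst_case_nat)
next
  case (Exists p)
  have "sat (\<lambda>i. abs_mnat (\<sigma> i)) (Exists p) \<longleftrightarrow> (\<exists>t. sat (case_nat (abs_mnat t) (\<lambda>i. abs_mnat (\<sigma> i))) p)"
    by (metis mnat_exhaust sat.simps(8))
  then show ?case
    by (simp add: case_nat_abs_mnat Exists.IH henkin_Exists[OF completion(1)] subst_case_nat)
qed (simp_all add: eval_abs_mnat henkin_Fls[OF completion(1)] henkin_Conj[OF completion(1)]
    henkin_Disj[OF completion(1)] henkin_Imp[OF completion(1)] mnat.abs_eq_iff less_mnat.abs_eq)

lemma truth_completion: "p \<in> completion \<Longrightarrow> fv p = 0 \<Longrightarrow> sat (e :: nat \<Rightarrow> mnat) p"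
  using truth[of "\<lambda>i. rep_mnat (e i)" p] by (simp add: subst_closed Quotient3_abs_rep[OF Quotient3_mnat])

lemma sat_uclD:
  assumes "\<And>e :: nat \<Rightarrow> 'a::{zero,one,plus,times,ord}. sat e (ucl p)"
  shows "sat (e :: nat \<Rightarrow> 'a) p"
proof -
  have "(\<And>e :: nat \<Rightarrow> 'a. sat e ((Forall ^^ n) p)) \<Longrightarrow> sat e p" for n and e :: "nat \<Rightarrow> 'a"
  proof (induction n arbitrary: e p)
    case (Suc n)
    have "sat (\<lambda>i. e (Suc i)) (Forall p)"
      by (rule Suc.IH) (use Suc.prems in \<open>simp only: funpow_Suc_right o_apply\<close>)
    then have "sat (case_nat (e 0) (\<lambda>i. e (Suc i))) p" by simp
    moreover have "case_nat (e 0) (\<lambda>i. e (Suc i)) = e" by (auto split: nat.split)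
    ultimately show ?case by simp
  qed simp
  from this[of "fv p"] show ?thesis using assms unfolding ucl_def by blast
qed

lemma sat_ISigma1: "ucl p \<in> ISigma1 \<Longrightarrow> sat (e :: nat \<Rightarrow> mnat) p"
  by (rule sat_uclD) (simp add: truth_completion ISigma1_completion fv_ucl)

text \<open>If totality were unprovable, \<open>completion\<close> would contain its negation and
  all of \<open>PSigma1\<close>, and \<open>mnat\<close> would be a countermodel. Otherwise
  \<open>mnat\<close> is only known to satisfy \<open>ISigma1\<close>, which is why the axioms of
  \<open>PSigma1\<close> enter as an assumption here and in \<open>ack_total\<close>.\<close>

lemma provable_totality:
  assumes "(\<And>p (e :: nat \<Rightarrow> mnat). ucl p \<in> PSigma1 \<Longrightarrow> sat e p) \<Longrightarrow> sat (e :: nat \<Rightarrow> mnat) totality"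
  shows "PSigma1 \<turnstile> totality"
proof (rule ccontr)
  assume "\<not> (PSigma1 \<turnstile> totality)"
  then have "consistent (insert (Neg totality) PSigma1)"
    unfolding consistent_def using provable.Boole by blast
  then have sub: "insert (Neg totality) PSigma1 \<subseteq> completion"
    using completion(2) by (simp only: base_theory_def if_True)
  have "sat e totality"
    by (rule assms, rule sat_uclD, rule truth_completion) (use sub fv_ucl in blast)+
  then have "subst (\<lambda>i. rep_mnat (e i)) totality \<in> completion"
    using truth[of "\<lambda>i. rep_mnat (e i)" totality]
    by (simp only: Quotient3_abs_rep[OF Quotient3_mnat])
  then have "totality \<in> completion" by (simp only: subst_closed totality_closed)
  then show False using sub henkin_Neg[OF completion(1)] by blast
qed

section \<open>Definable predicates of the model\<close>

definition parameter :: "nat \<Rightarrow> mnat" where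
  "parameter i = abs_mnat (from_nat i)"

lemma parameter_surj: obtains i where "x = parameter i"
  by (metis mnat_exhaust from_nat_to_nat parameter_def)

text \<open>
  The variables of a formula with even index refer to the environment, the ones with odd index
  to an enumeration of the countable model.  In this way every element of the model
  is a term, and the definable predicates are closed under parameters.
\<close>

definition mix :: "(nat \<Rightarrow> mnat) \<Rightarrow> nat \<Rightarrow> mnat" where
  "mix e i = (if even i then e (i div 2) else parameter (i div 2))"

text \<open>Definability is a property of HOL functions and predicates, not of syntax. Statements
  can therefore be written directly in HOL, and their complexity is checked by introduction
  rules.\<close>

definition is_term :: "((nat \<Rightarrow> mnat) \<Rightarrow> mnat) \<Rightarrow> bool" where
  "is_term f \<longleftrightarrow> (\<exists>t. \<forall>e. f e = eval (mix e) t)"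

definition is_delta0 :: "((nat \<Rightarrow> mnat) \<Rightarrow> bool) \<Rightarrow> bool" where
  "is_delta0 P \<longleftrightarrow> (\<exists>p. delta0 p \<and> (\<forall>e. P e \<longleftrightarrow> sat (mix e) p))"

definition is_sigma1 :: "((nat \<Rightarrow> mnat) \<Rightarrow> bool) \<Rightarrow> bool" where
  "is_sigma1 P \<longleftrightarrow> (\<exists>p. sigma1 p \<and> (\<forall>e. P e \<longleftrightarrow> sat (mix e) p))"

lemma is_term_var: "is_term (\<lambda>e. e k)"
  unfolding is_term_def by (rule exI[of _ "Var (2 * k)"]) (simp add: mix_def)

lemma is_term_const: "is_term (\<lambda>e. c)"
proof -
  obtain k where "c = parameter k" by (rule parameter_surj)
  then show ?thesis unfolding is_term_def by (intro exI[of _ "Var (2 * k + 1)"]) (simp add: mix_def)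
qed

lemma is_term_add: "is_term f \<Longrightarrow> is_term g \<Longrightarrow> is_term (\<lambda>e. f e + g e)"
  unfolding is_term_def by (metis eval.simps(4))

lemma is_term_mult: "is_term f \<Longrightarrow> is_term g \<Longrightarrow> is_term (\<lambda>e. f e * g e)"
  unfolding is_term_def by (metis eval.simps(5))

lemmas is_term_intros = is_term_var is_term_add is_term_mult is_term_const

lemma subst_ball: "subst \<sigma> (ball t p) = ball (substt \<sigma> t) (subst (under \<sigma>) p)"
  using substt_liftt[of \<sigma> t] by (simp add: ball_def under_def)

lemma subst_bex: "subst \<sigma> (bex t p) = bex (substt \<sigma> t) (subst (under \<sigma>) p)"
  using substt_liftt[of \<sigma> t] by (simp add: bex_def under_def)

lemma delta0_subst: "delta0 p \<Longrightarrow> delta0 (subst \<sigma> p)"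
  by (induction arbitrary: \<sigma> rule: delta0.induct) (auto simp: subst_ball subst_bex intro: delta0.intros)

lemma sigma1_subst: "sigma1 p \<Longrightarrow> sigma1 (subst \<sigma> p)"
  by (induction arbitrary: \<sigma> rule: sigma1.induct) (auto intro: delta0_subst sigma1.intros)

lemma sat_ball [simp]: "sat e (ball t p) \<longleftrightarrow> (\<forall>x<eval e t. sat (case_nat x e) p)"
  by (simp add: ball_def)

lemma sat_bex [simp]: "sat e (bex t p) \<longleftrightarrow> (\<exists>x<eval e t. sat (case_nat x e) p)"
  by (simp add: bex_def)

text \<open>Only the even variables, which read the environment, are replaced; the odd ones keep
  denoting the same parameters.\<close>

lemma mix_subst:
  assumes "\<And>i. is_term (\<lambda>e. g e i)"
  obtains \<sigma> where "\<And>e. mix (g e) = (\<lambda>i. eval (mix e) (\<sigma> i))"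
proof -
  obtain t where t: "\<And>i e. g e i = eval (mix e) (t i)"
    using assms unfolding is_term_def by metis
  have "mix (g e) = (\<lambda>i. eval (mix e) (if even i then t (i div 2) else Var i))" for e
    by (rule ext) (simp add: mix_def[of "g e"] t, simp add: mix_def)
  then show thesis by (rule that)
qed

lemma is_delta0_subst:
  assumes "is_delta0 P" "\<And>i. is_term (\<lambda>e. g e i)"
  shows "is_delta0 (\<lambda>e. P (g e))"
proof -
  obtain \<sigma> where "\<And>e. mix (g e) = (\<lambda>i. eval (mix e) (\<sigma> i))"
    using mix_subst assms(2) by blast
  then show ?thesis
    using assms(1) unfolding is_delta0_def by (metis delta0_subst sat_subst)
qed

lemma is_sigma1_subst:
  assumes "is_sigma1 P" "\<And>i. is_term (\<lambda>e. g e i)"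
  shows "is_sigma1 (\<lambda>e. P (g e))"
proof -
  obtain \<sigma> where "\<And>e. mix (g e) = (\<lambda>i. eval (mix e) (\<sigma> i))"
    using mix_subst assms(2) by blast
  then show ?thesis
    using assms(1) unfolding is_sigma1_def by (metis sigma1_subst sat_subst)
qed

lemma is_delta0_1:
  assumes "is_delta0 (\<lambda>e. P (e 0))" "is_term f"
  shows "is_delta0 (\<lambda>e. P (f e))"
  using is_delta0_subst[OF assms(1), of "\<lambda>e i. f e"] assms(2) by simp

lemma is_delta0_2:
  assumes "is_delta0 (\<lambda>e. P (e 0) (e 1))" "is_term f" "is_term g"
  shows "is_delta0 (\<lambda>e. P (f e) (g e))"
proof -
  have "is_term (\<lambda>e. if i = 0 then f e else g e)" for i :: nat
    using assms(2,3) by (cases "i = 0") simp_all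
  from is_delta0_subst[OF assms(1), of "\<lambda>e i. if i = 0 then f e else g e", OF this]
  show ?thesis by simp
qed

lemma is_sigma1_2:
  assumes "is_sigma1 (\<lambda>e. P (e 0) (e 1))" "is_term f" "is_term g"
  shows "is_sigma1 (\<lambda>e. P (f e) (g e))"
proof -
  have "is_term (\<lambda>e. if i = 0 then f e else g e)" for i :: nat
    using assms(2,3) by (cases "i = 0") simp_all
  from is_sigma1_subst[OF assms(1), of "\<lambda>e i. if i = 0 then f e else g e", OF this]
  show ?thesis by simp
qed

text \<open>A quantifier shifts all variables by one and so interchanges the two parities; swapping
  2k+1 with 2k+2 restores the convention of \<open>mix\<close>.\<close>

definition unmix :: "nat \<Rightarrow> tm" where
  "unmix i = Var (if i = 0 then 0 else if even i then i - 1 else i + 1)"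

lemma eval_unmix: "(\<lambda>i. eval (case_nat x (mix e)) (unmix i)) = mix (case_nat x e)"
proof
  fix i show "eval (case_nat x (mix e)) (unmix i) = mix (case_nat x e) i"
  proof (cases "even i")
    case True
    then obtain k where "i = 2 * k" by blast
    then show ?thesis by (cases k) (simp_all add: unmix_def mix_def)
  next
    case False
    then show ?thesis by (simp add: unmix_def mix_def) (auto elim!: oddE)
  qed
qed

lemma is_delta0_eq: "is_term f \<Longrightarrow> is_term g \<Longrightarrow> is_delta0 (\<lambda>e. f e = g e)"
  unfolding is_term_def is_delta0_def by (metis delta0.intros(2) sat.simps(2))

lemma is_delta0_less: "is_term f \<Longrightarrow> is_term g \<Longrightarrow> is_delta0 (\<lambda>e. f e < g e)"
  unfolding is_term_def is_delta0_def by (metis delta0.intros(3) sat.simps(3))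

lemma is_delta0_conj: "is_delta0 P \<Longrightarrow> is_delta0 Q \<Longrightarrow> is_delta0 (\<lambda>e. P e \<and> Q e)"
  unfolding is_delta0_def by (metis delta0.intros(4) sat.simps(4))

lemma is_delta0_disj: "is_delta0 P \<Longrightarrow> is_delta0 Q \<Longrightarrow> is_delta0 (\<lambda>e. P e \<or> Q e)"
  unfolding is_delta0_def by (metis delta0.intros(5) sat.simps(5))

lemma is_delta0_imp: "is_delta0 P \<Longrightarrow> is_delta0 Q \<Longrightarrow> is_delta0 (\<lambda>e. P e \<longrightarrow> Q e)"
  unfolding is_delta0_def by (metis delta0.intros(6) sat.simps(6))

lemma is_delta0_not: "is_delta0 P \<Longrightarrow> is_delta0 (\<lambda>e. \<not> P e)"
  unfolding is_delta0_def by (metis delta0.intros(1,6) sat.simps(1,6))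

lemma is_delta0_le: "is_term f \<Longrightarrow> is_term g \<Longrightarrow> is_delta0 (\<lambda>e. f e \<le> g e)"
  unfolding less_eq_mnat_def by (intro is_delta0_disj is_delta0_less is_delta0_eq)

text \<open>In the premise the bound variable takes position 0 and the old environment is shifted: a
  de Bruijn binder in semantic form.\<close>

lemma is_delta0_ball:
  assumes "is_delta0 (\<lambda>e. Q (e 0) (\<lambda>i. e (Suc i)))" "is_term f"
  shows "is_delta0 (\<lambda>e. \<forall>x<f e. Q x e)"
proof -
  obtain p t where p: "delta0 p" "\<And>e. Q (e 0) (\<lambda>i. e (Suc i)) \<longleftrightarrow> sat (mix e) p"
    and t: "\<And>e. f e = eval (mix e) t"
    using assms unfolding is_delta0_def is_term_def by auto
  have "Q x e \<longleftrightarrow> sat (mix (case_nat x e)) p" for x e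
    using p(2)[of "case_nat x e"] by simp
  then show ?thesis
    using p(1) unfolding is_delta0_def
    by (intro exI[of _ "ball t (subst unmix p)"])
      (auto simp: t sat_subst eval_unmix intro: delta0.intros delta0_subst)
qed

lemma is_delta0_bex:
  assumes "is_delta0 (\<lambda>e. Q (e 0) (\<lambda>i. e (Suc i)))" "is_term f"
  shows "is_delta0 (\<lambda>e. \<exists>x<f e. Q x e)"
proof -
  obtain p t where p: "delta0 p" "\<And>e. Q (e 0) (\<lambda>i. e (Suc i)) \<longleftrightarrow> sat (mix e) p"
    and t: "\<And>e. f e = eval (mix e) t"
    using assms unfolding is_delta0_def is_term_def by auto
  have "Q x e \<longleftrightarrow> sat (mix (case_nat x e)) p" for x e
    using p(2)[of "case_nat x e"] by simp
  then show ?thesis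
    using p(1) unfolding is_delta0_def
    by (intro exI[of _ "bex t (subst unmix p)"])
      (auto simp: t sat_subst eval_unmix intro: delta0.intros delta0_subst)
qed

lemma is_sigma1_ex:
  assumes "is_sigma1 (\<lambda>e. Q (e 0) (\<lambda>i. e (Suc i)))"
  shows "is_sigma1 (\<lambda>e. \<exists>x. Q x e)"
proof -
  obtain p where p: "sigma1 p" "\<And>e. Q (e 0) (\<lambda>i. e (Suc i)) \<longleftrightarrow> sat (mix e) p"
    using assms unfolding is_sigma1_def by auto
  have "Q x e \<longleftrightarrow> sat (mix (case_nat x e)) p" for x e
    using p(2)[of "case_nat x e"] by simp
  then show ?thesis
    using p(1) unfolding is_sigma1_def
    by (intro exI[of _ "Exists (subst unmix p)"])
      (auto simp: sat_subst eval_unmix intro: sigma1.intros sigma1_subst)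
qed

lemma is_sigma1_delta0: "is_delta0 P \<Longrightarrow> is_sigma1 P"
  unfolding is_sigma1_def is_delta0_def by (blast intro: sigma1.intros)

lemmas is_delta0_intros = is_delta0_eq is_delta0_less is_delta0_le is_delta0_conj is_delta0_disj
  is_delta0_not is_delta0_imp is_delta0_ball is_delta0_bex

section \<open>The axioms and \<Sigma>_1 induction as statements about the model\<close>

lemma mnat_axioms:
  fixes x y :: mnat
  shows "x + 1 \<noteq> 0" "x + 1 = y + 1 \<Longrightarrow> x = y" "x + 0 = x" "x + (y + 1) = (x + y) + 1"
    "x * 0 = 0" "x * (y + 1) = x * y + x" "\<not> x < 0" "x < y + 1 \<longleftrightarrow> x < y \<or> x = y"
proof -
  let ?e = "case_nat x (\<lambda>_. y)"
  have ax: "sat ?e p" if "ucl p \<in> PA_basic" for p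
    using that by (intro sat_ISigma1) (simp add: ISigma1_def)
  show "x + 1 \<noteq> 0" using ax[of "Neg (Succ (Var 0) \<^bold>= Zero)"] by (simp add: PA_basic_def)
  show "x = y" if "x + 1 = y + 1"
    using ax[of "Succ (Var 0) \<^bold>= Succ (Var 1) \<^bold>\<longrightarrow> Var 0 \<^bold>= Var 1"] that by (simp add: PA_basic_def)
  show "x + 0 = x" using ax[of "Var 0 \<^bold>+ Zero \<^bold>= Var 0"] by (simp add: PA_basic_def)
  show "x + (y + 1) = (x + y) + 1"
    using ax[of "Var 0 \<^bold>+ Succ (Var 1) \<^bold>= Succ (Var 0 \<^bold>+ Var 1)"] by (simp add: PA_basic_def)
  show "x * 0 = 0" using ax[of "Var 0 \<^bold>* Zero \<^bold>= Zero"] by (simp add: PA_basic_def)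
  show "x * (y + 1) = x * y + x"
    using ax[of "Var 0 \<^bold>* Succ (Var 1) \<^bold>= Var 0 \<^bold>* Var 1 \<^bold>+ Var 0"] by (simp add: PA_basic_def)
  show "\<not> x < 0" using ax[of "Neg (Var 0 \<^bold>< Zero)"] by (simp add: PA_basic_def)
  show "x < y + 1 \<longleftrightarrow> x < y \<or> x = y"
    using ax[of "Iff (Var 0 \<^bold>< Succ (Var 1)) (Var 0 \<^bold>< Var 1 \<^bold>\<or> Var 0 \<^bold>= Var 1)"]
    by (auto simp: PA_basic_def)
qed

text \<open>The axiom schemes expect the arguments as variables 0 and 1 and everything else as
  parameters; the environment \<open>c\<close> supplies the enumerated elements of the
  model.\<close>

lemma sigma1_formula_2:
  assumes "is_sigma1 (\<lambda>e. P (e 0) (e 1))"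
  obtains p c where "sigma1 p" "\<And>x y. sat (case_nat x (case_nat y c)) p \<longleftrightarrow> P x y"
proof -
  obtain p where p: "sigma1 p" "\<And>e. P (e 0) (e 1) \<longleftrightarrow> sat (mix e) p"
    using assms unfolding is_sigma1_def by auto
  let ?\<sigma> = "\<lambda>i. Var (if i = 0 then 0 else if i = 2 then 1 else i + 2)"
  let ?c = "mix (\<lambda>_. 0)"
  have "(\<lambda>i. eval (case_nat x (case_nat y ?c)) (?\<sigma> i)) =
    mix (\<lambda>i. if i = 0 then x else if i = 1 then y else 0)" for x y
    by (auto simp: fun_eq_iff mix_def)
  then have "sat (case_nat x (case_nat y ?c)) (subst ?\<sigma> p) \<longleftrightarrow> P x y" for x y
    using p(2)[of "\<lambda>i. if i = 0 then x else if i = 1 then y else 0"] by (simp add: sat_subst)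
  then show thesis using that p(1) sigma1_subst by blast
qed

lemma sigma1_induct:
  assumes "is_sigma1 (\<lambda>e. P (e 0))" "P 0" "\<And>x. P x \<Longrightarrow> P (x + 1)"
  shows "P x"
proof -
  obtain p c where p: "sigma1 p" "\<And>x y. sat (case_nat x (case_nat y c)) p \<longleftrightarrow> P x"
    using sigma1_formula_2[of "\<lambda>x y. P x"] assms(1) by blast
  have "ucl (induction_ax p) \<in> ISigma1"
    using p(1) by (auto simp: ISigma1_def)
  then have "sat (case_nat 0 c) (induction_ax p)" by (rule sat_ISigma1)
  then show ?thesis
    using assms(2,3) by (simp add: induction_ax_def sat_inst_single sat_inst_1 p(2))
qed

lemmas delta0_induct = sigma1_induct[OF is_sigma1_delta0]

section \<open>Arithmetic in the model\<close>

lemma mnat_Succ_inject: "x + 1 = y + 1 \<longleftrightarrow> x = (y :: mnat)"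
  using mnat_axioms(2) by blast

lemmas mnat_simps = mnat_Succ_inject mnat_axioms(1,3-8)

lemma mnat_zero_add: "0 + x = (x :: mnat)"
  by (rule delta0_induct[where P = "\<lambda>x. 0 + x = x"])
    (intro is_delta0_intros is_term_intros | simp add: mnat_simps)+

lemma mnat_Succ_add: "(x + 1) + y = (x + y) + (1 :: mnat)"
  by (rule delta0_induct[where P = "\<lambda>y. (x + 1) + y = (x + y) + 1"])
    (intro is_delta0_intros is_term_intros | simp add: mnat_simps)+

lemma mnat_add_commute: "x + y = y + (x :: mnat)"
proof (rule delta0_induct[where P = "\<lambda>y. x + y = y + x"])
  show "is_delta0 (\<lambda>e. x + e 0 = e 0 + x)"
    by (intro is_delta0_intros is_term_intros)
qed (simp_all only: mnat_axioms(3,4) mnat_zero_add mnat_Succ_add)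

lemma mnat_add_assoc: "(x + y) + z = x + (y + z :: mnat)"
  by (rule delta0_induct[where P = "\<lambda>z. (x + y) + z = x + (y + z)"])
    (intro is_delta0_intros is_term_intros | simp add: mnat_simps)+

lemma mnat_zero_mult: "0 * x = (0 :: mnat)"
  by (rule delta0_induct[where P = "\<lambda>x. 0 * x = 0"])
    (intro is_delta0_intros is_term_intros | simp add: mnat_simps)+

lemma mnat_Succ_mult: "(x + 1) * y = x * y + (y :: mnat)"
proof (rule delta0_induct[where P = "\<lambda>y. (x + 1) * y = x * y + y"])
  show "is_delta0 (\<lambda>e. (x + 1) * e 0 = x * e 0 + e 0)"
    by (intro is_delta0_intros is_term_intros)
next
  fix y assume "(x + 1) * y = x * y + y"
  then show "(x + 1) * (y + 1) = x * (y + 1) + (y + 1)"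
    by (simp add: mnat_simps) (metis mnat_add_assoc mnat_add_commute)
qed (simp add: mnat_simps)

lemma mnat_mult_commute: "x * y = y * (x :: mnat)"
  by (rule delta0_induct[where P = "\<lambda>y. x * y = y * x"])
    (intro is_delta0_intros is_term_intros | simp add: mnat_simps mnat_zero_mult mnat_Succ_mult)+

lemma mnat_distrib: "(x + y) * z = x * z + y * (z :: mnat)"
proof (rule delta0_induct[where P = "\<lambda>z. (x + y) * z = x * z + y * z"])
  show "is_delta0 (\<lambda>e. (x + y) * e 0 = x * e 0 + y * e 0)"
    by (intro is_delta0_intros is_term_intros)
next
  fix z assume "(x + y) * z = x * z + y * z"
  then show "(x + y) * (z + 1) = x * (z + 1) + y * (z + 1)"
    by (simp add: mnat_simps) (metis mnat_add_assoc mnat_add_commute)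
qed (simp add: mnat_simps)

lemma mnat_distrib_left: "x * (y + z) = x * y + x * (z :: mnat)"
  using mnat_distrib[of y z x] by (simp only: mnat_mult_commute)

lemma mnat_mult_1: "x * 1 = (x :: mnat)"
  using mnat_axioms(6)[of x 0] by (simp only: mnat_zero_add mnat_axioms(5))

lemma mnat_mult_assoc: "(x * y) * z = x * (y * z :: mnat)"
  by (rule delta0_induct[where P = "\<lambda>z. (x * y) * z = x * (y * z)"])
    (intro is_delta0_intros is_term_intros | simp add: mnat_simps mnat_distrib_left mnat_mult_1)+

lemma mnat_add_left_cancel: "x + y = x + z \<Longrightarrow> y = (z :: mnat)"
proof -
  have "y + x = z + x \<longrightarrow> y = z"
    by (rule delta0_induct[where P = "\<lambda>x. y + x = z + x \<longrightarrow> y = z"])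
      (intro is_delta0_intros is_term_intros | simp add: mnat_simps)+
  then show "x + y = x + z \<Longrightarrow> y = z" by (simp only: mnat_add_commute)
qed

lemma mnat_less_add: "x < x + (z + 1 :: mnat)"
  by (rule delta0_induct[where P = "\<lambda>z. x < x + (z + 1)"])
    (intro is_delta0_intros is_term_intros | simp add: mnat_simps)+

text \<open>\<open><\<close> is a primitive symbol with axioms about 0 and successor only;
  expressing it by addition reduces the order laws to algebra. The quantifier stands in front of the
  implication to give the induction formula \<Sigma>_1 form.\<close>

lemma mnat_less_imp_add: "x < y \<Longrightarrow> \<exists>z. y = x + (z + 1 :: mnat)"
proof -
  have "\<exists>z. x < y \<longrightarrow> y = x + (z + 1)"
  proof (rule sigma1_induct[where P = "\<lambda>y. \<exists>z. x < y \<longrightarrow> y = x + (z + 1)"])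
    show "is_sigma1 (\<lambda>e. \<exists>z. x < e 0 \<longrightarrow> e 0 = x + (z + 1))"
      by (intro is_sigma1_ex is_sigma1_delta0 is_delta0_intros is_term_intros)
  next
    fix y assume "\<exists>z. x < y \<longrightarrow> y = x + (z + 1)"
    then show "\<exists>z. x < y + 1 \<longrightarrow> y + 1 = x + (z + 1)"
      by (metis mnat_axioms(3,4,8) mnat_zero_add)
  qed (simp add: mnat_simps)
  then show "x < y \<Longrightarrow> \<exists>z. y = x + (z + 1)" by blast
qed

lemma mnat_less_iff: "x < y \<longleftrightarrow> (\<exists>z. y = x + (z + 1 :: mnat))"
  using mnat_less_add mnat_less_imp_add by blast

lemma mnat_cases: "x = (0 :: mnat) \<or> (\<exists>y. x = y + 1)"
proof -
  have "\<exists>y. x = 0 \<or> x = y + 1"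
    by (rule sigma1_induct[where P = "\<lambda>x. \<exists>y. x = 0 \<or> x = y + 1"])
      (intro is_sigma1_ex is_sigma1_delta0 is_delta0_intros is_term_intros | blast)+
  then show ?thesis by blast
qed

lemma mnat_le_iff: "x \<le> y \<longleftrightarrow> (\<exists>z. y = x + (z :: mnat))"
  unfolding less_eq_mnat_def mnat_less_iff by (metis mnat_cases mnat_simps(3))

lemma mnat_linear: "x \<le> y \<or> y \<le> (x :: mnat)"
proof -
  have "x < y \<or> x = y \<or> y < x"
  proof (rule delta0_induct[where P = "\<lambda>y. x < y \<or> x = y \<or> y < x"])
    show "is_delta0 (\<lambda>e. x < e 0 \<or> x = e 0 \<or> e 0 < x)"
      by (intro is_delta0_intros is_term_intros)
    show "x < 0 \<or> x = 0 \<or> 0 < x"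
      using mnat_cases[of x] by (auto simp: mnat_less_iff mnat_zero_add)
    fix y assume "x < y \<or> x = y \<or> y < x"
    then show "x < y + 1 \<or> x = y + 1 \<or> y + 1 < x"
    proof (elim disjE)
      assume "y < x"
      then obtain z where z: "x = y + (z + 1)" using mnat_less_imp_add by blast
      have less: "y + 1 < x" if w: "z = w + 1" for w
      proof -
        have "x = y + 1 + (w + 1)"
          unfolding z w by (simp only: mnat_axioms(4) mnat_Succ_add[of y w])
        then show ?thesis by (simp only: mnat_less_add)
      qed
      consider "z = 0" | w where "z = w + 1" using mnat_cases by blast
      then show ?thesis
      proof cases
        case 1
        then show ?thesis unfolding z by (simp add: mnat_zero_add)
      next
        case 2
        then show ?thesis using less by blast
      qed
    qed (use mnat_axioms(8) in blast)+
  qed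
  then show ?thesis unfolding less_eq_mnat_def by blast
qed

text \<open>After this the library's arithmetic is available for the model. The class requires a
  subtraction, for which truncated difference is chosen; it is not a term of the language, so
  definable predicates are stated with addition instead.\<close>

instantiation mnat :: linordered_semidom
begin

definition minus_mnat :: "mnat \<Rightarrow> mnat \<Rightarrow> mnat" where
  "minus_mnat x y = (if y \<le> x then THE z. x = y + z else 0)"

instance
proof
  fix a b c :: mnat
  have diff: "(a + b) - a = b" for a b :: mnat
    unfolding minus_mnat_def mnat_le_iff using mnat_add_left_cancel[of a b] by (auto intro: the_equality)
  have antisym: "x = y" if "x \<le> y" "y \<le> x" for x y :: mnat
    using that unfolding mnat_le_iff
    by (metis mnat_add_assoc mnat_add_left_cancel mnat_axioms(1,3,4) mnat_cases)
  have zero: "0 \<le> x" for x :: mnat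
    unfolding mnat_le_iff by (metis mnat_zero_add)
  have less: "x < y \<longleftrightarrow> x \<le> y \<and> \<not> y \<le> x" for x y :: mnat
    using antisym mnat_less_iff less_eq_mnat_def
    by (metis mnat_add_left_cancel mnat_axioms(1,3))
  show "a + b + c = a + (b + c)" by (rule mnat_add_assoc)
  show "a + b = b + a" by (rule mnat_add_commute)
  show "0 + a = a" by (rule mnat_zero_add)
  show "a * b * c = a * (b * c)" by (rule mnat_mult_assoc)
  show "a * b = b * a" by (rule mnat_mult_commute)
  show "1 * a = a" using mnat_Succ_mult[of 0 a] by (simp add: mnat_zero_add mnat_zero_mult)
  show "(a + b) * c = a * c + b * c" by (rule mnat_distrib)
  show "a * (b + c) = a * b + a * c" by (rule mnat_distrib_left)
  show "0 * a = 0" by (rule mnat_zero_mult)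
  show "a * 0 = 0" by (rule mnat_axioms)
  show "(0 :: mnat) \<noteq> 1" using mnat_axioms(1)[of 0] by (simp add: mnat_zero_add)
  show "a + b - a = b" by (rule diff)
  have not_le: "x - y = 0" if "\<not> y \<le> x" for x y :: mnat
    using that by (simp add: minus_mnat_def)
  have self: "x - x = 0" for x :: mnat
    using diff[of x 0] by (simp add: mnat_simps)
  have zero_diff: "0 - x = 0" for x :: mnat
    using not_le[of x 0] self[of 0] antisym[of x 0] zero by metis
  show "a - b - c = a - (b + c)"
  proof (cases "b \<le> a")
    case True
    then obtain d where d: "a = b + d" unfolding mnat_le_iff by blast
    show ?thesis
    proof (cases "c \<le> d")
      case True
      then obtain d' where "d = c + d'" unfolding mnat_le_iff by blast
      then show ?thesis using diff[of "b + c" d'] by (simp add: d diff mnat_add_assoc)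
    next
      case False
      then have "\<not> b + c \<le> a"
        unfolding d mnat_le_iff mnat_add_assoc using mnat_add_left_cancel by blast
      then show ?thesis using False by (simp add: d diff not_le)
    qed
  next
    case False
    then have "\<not> b + c \<le> a" unfolding mnat_le_iff mnat_add_assoc by blast
    then show ?thesis using False by (simp add: not_le zero_diff)
  qed
  show "a * (b - c) = a * b - a * c"
  proof (cases "c \<le> b")
    case True
    then obtain d where "b = c + d" unfolding mnat_le_iff by blast
    then show ?thesis by (simp add: diff mnat_distrib_left)
  next
    case False
    then obtain d where "c = b + d" using mnat_linear unfolding mnat_le_iff by blast
    then have "a * c = a * b + a * d" by (simp add: mnat_distrib_left)
    then have "a * b \<le> a * c" unfolding mnat_le_iff by blast
    then have "a * b - a * c = 0" using not_le self antisym by metis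
    then show ?thesis using False by (simp add: not_le mnat_simps)
  qed
  show "a < b \<longleftrightarrow> a \<le> b \<and> \<not> b \<le> a" by (rule less)
  show "a \<le> a" by (simp add: less_eq_mnat_def)
  show "a \<le> b \<Longrightarrow> b \<le> c \<Longrightarrow> a \<le> c" unfolding mnat_le_iff by (metis mnat_add_assoc)
  show "a \<le> b \<Longrightarrow> b \<le> a \<Longrightarrow> a = b" by (rule antisym)
  show "a \<le> b \<or> b \<le> a" by (rule mnat_linear)
  show "a \<le> b \<Longrightarrow> c + a \<le> c + b" unfolding mnat_le_iff by (metis mnat_add_assoc)
  show "(0 :: mnat) < 1" using mnat_less_add[of 0 0] by (simp add: mnat_zero_add)
  show "a < b \<Longrightarrow> 0 < c \<Longrightarrow> c * a < c * b"
  proof -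
    assume "a < b" "0 < c"
    then obtain z w where b: "b = a + (z + 1)" and c: "c = w + 1"
      unfolding mnat_less_iff mnat_zero_add by blast
    have "c * b = c * a + (c * z + w + 1)"
      unfolding b mnat_distrib_left mnat_axioms(6) using c by (simp add: mnat_add_assoc mnat_mult_1)
    then show ?thesis unfolding mnat_less_iff by blast
  qed
  show "b \<le> a \<Longrightarrow> a - b + b = a"
    using diff unfolding mnat_le_iff by (metis mnat_add_commute)
  show "a \<noteq> 0 \<Longrightarrow> b \<noteq> 0 \<Longrightarrow> a * b \<noteq> 0"
    by (metis mnat_axioms(1,4,6) mnat_cases)
qed

end

instance mnat :: ordered_cancel_comm_monoid_diff
proof
  fix a b :: mnat
  show le: "a \<le> b \<longleftrightarrow> (\<exists>c. b = a + c)" for a b :: mnat by (rule mnat_le_iff)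
  have "0 \<le> a" unfolding le by simp
  then show "0 - a = 0"
    by (cases "a = 0") (simp_all add: minus_mnat_def[of 0 a] antisym_conv)
qed

lemma less_add_1_iff: "x < y + 1 \<longleftrightarrow> x \<le> (y :: mnat)"
  unfolding mnat_axioms(8) less_eq_mnat_def ..

lemma less_iff_add_1_le: "x < y \<longleftrightarrow> x + 1 \<le> (y :: mnat)"
  using less_add_1_iff[of y x] linorder_not_less[of x y] linorder_not_less[of y "x + 1"] by blast

lemma less_add_1_cases: "i < j + 1 \<longleftrightarrow> i < j \<or> i = (j :: mnat)"
  by (rule mnat_axioms(8))

section \<open>Closure properties of \<Sigma>_1 predicates, collection, least elements\<close>

lemma is_term_subst:
  assumes "is_term f" "\<And>i. is_term (\<lambda>e. g e i)"
  shows "is_term (\<lambda>e. f (g e))"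
proof -
  obtain \<sigma> where "\<And>e. mix (g e) = (\<lambda>i. eval (mix e) (\<sigma> i))"
    using mix_subst assms(2) by blast
  then show ?thesis
    using assms(1) eval_substt[of "mix _" \<sigma>] unfolding is_term_def by metis
qed

lemma is_delta0_env:
  assumes "is_delta0 (\<lambda>e. Q (e 0) (\<lambda>i. e (Suc i)))" "is_term f" "\<And>i. is_term (\<lambda>e. g e i)"
  shows "is_delta0 (\<lambda>e. Q (f e) (g e))"
proof -
  have "is_term (\<lambda>e. case_nat (f e) (g e) i)" for i
    using assms(2,3) by (cases i) simp_all
  from is_delta0_subst[OF assms(1), of "\<lambda>e. case_nat (f e) (g e)", OF this]
  show ?thesis by simp
qed

text \<open>\<open>sigma1\<close> allows only leading existential quantifiers, so further closure
  properties hold up to equivalence in the model. Two such quantifiers contract to one that bounds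
  both witnesses; their maximum is a suitable value.\<close>

lemma sigma1_prenex:
  "sigma1 p \<Longrightarrow> \<exists>q. delta0 q \<and> (\<forall>e :: nat \<Rightarrow> mnat. sat e p \<longleftrightarrow> (\<exists>y. sat (case_nat y e) q))"
proof (induction rule: sigma1.induct)
  case (1 p)
  then show ?case
    by (intro exI[of _ "lift 1 p"]) (simp add: lift_def sat_subst delta0_subst)
next
  case (2 p)
  then obtain q where q: "delta0 q"
    "\<And>e :: nat \<Rightarrow> mnat. sat e p \<longleftrightarrow> (\<exists>y. sat (case_nat y e) q)" by blast
  let ?\<sigma> = "\<lambda>i. Var (if i < 2 then i else i + 1)"
  let ?q = "bex (Succ (Var 0)) (bex (Succ (Var 1)) (subst ?\<sigma> q))"
  have env: "(\<lambda>i. eval (case_nat y (case_nat x (case_nat z e))) (?\<sigma> i)) = case_nat y (case_nat x e)"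
    for x y z and e :: "nat \<Rightarrow> mnat"
    by (auto simp: fun_eq_iff less_2_cases_iff split: nat.split)
  have "sat e (Exists p) \<longleftrightarrow> (\<exists>z. sat (case_nat z e) ?q)" for e :: "nat \<Rightarrow> mnat"
  proof
    assume "sat e (Exists p)"
    then obtain x y where "sat (case_nat y (case_nat x e)) q" by (auto simp: q(2))
    then have "x < max x y + 1 \<and> y < max x y + 1 \<and> sat (case_nat y (case_nat x e)) q"
      by (simp add: less_add_1_iff)
    then have "sat (case_nat (max x y) e) ?q"
      unfolding sat_bex sat_subst env by auto
    then show "\<exists>z. sat (case_nat z e) ?q" ..
  next
    assume "\<exists>z. sat (case_nat z e) ?q"
    then show "sat e (Exists p)"
      by (auto simp: sat_subst env q(2) simp del: eval.simps(1))
  qed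
  moreover have "delta0 ?q"
    using q(1) by (intro delta0.intros delta0_subst)
  ultimately show ?case by blast
qed

lemma is_sigma1_prenex:
  assumes "is_sigma1 P"
  obtains Q where "is_delta0 (\<lambda>e. Q (e 0) (\<lambda>i. e (Suc i)))" "\<And>e. P e \<longleftrightarrow> (\<exists>y. Q y e)"
proof -
  obtain p where p: "sigma1 p" "\<And>e. P e \<longleftrightarrow> sat (mix e) p"
    using assms unfolding is_sigma1_def by blast
  obtain q where q: "delta0 q"
    "\<And>e :: nat \<Rightarrow> mnat. sat e p \<longleftrightarrow> (\<exists>y. sat (case_nat y e) q)"
    using sigma1_prenex[OF p(1)] by blast
  let ?\<sigma> = "\<lambda>i. Var (if i = 0 then 0 else if odd i then i + 1 else i - 1)"
  have "(\<lambda>i. eval (mix e) (?\<sigma> i)) = case_nat (e 0) (mix (\<lambda>i. e (Suc i)))" for e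
  proof
    fix i show "eval (mix e) (?\<sigma> i) = case_nat (e 0) (mix (\<lambda>i. e (Suc i))) i"
      by (cases i) (auto simp: mix_def elim!: oddE)
  qed
  then have "is_delta0 (\<lambda>e. sat (case_nat (e 0) (mix (\<lambda>i. e (Suc i)))) q)"
    unfolding is_delta0_def using q(1)
    by (intro exI[of _ "subst ?\<sigma> q"]) (simp add: sat_subst delta0_subst del: eval.simps)
  then show thesis
    by (rule that[of "\<lambda>y e. sat (case_nat y (mix e)) q"]) (simp add: p q)
qed

lemma is_sigma1_conj:
  assumes "is_sigma1 P" "is_sigma1 Q"
  shows "is_sigma1 (\<lambda>e. P e \<and> Q e)"
proof -
  obtain P' where P': "is_delta0 (\<lambda>e. P' (e 0) (\<lambda>i. e (Suc i)))" "\<And>e. P e \<longleftrightarrow> (\<exists>y. P' y e)"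
    using is_sigma1_prenex[OF assms(1)] by blast
  obtain Q' where Q': "is_delta0 (\<lambda>e. Q' (e 0) (\<lambda>i. e (Suc i)))" "\<And>e. Q e \<longleftrightarrow> (\<exists>y. Q' y e)"
    using is_sigma1_prenex[OF assms(2)] by blast
  have "is_sigma1 (\<lambda>e. \<exists>x. \<exists>y. P' x e \<and> Q' y e)"
    by (intro is_sigma1_ex is_sigma1_delta0 is_delta0_conj is_delta0_env[OF P'(1)]
        is_delta0_env[OF Q'(1)] is_term_var)
  then show ?thesis by (simp add: P' Q')
qed

lemma is_sigma1_disj:
  assumes "is_sigma1 P" "is_sigma1 Q"
  shows "is_sigma1 (\<lambda>e. P e \<or> Q e)"
proof -
  obtain P' where P': "is_delta0 (\<lambda>e. P' (e 0) (\<lambda>i. e (Suc i)))" "\<And>e. P e \<longleftrightarrow> (\<exists>y. P' y e)"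
    using is_sigma1_prenex[OF assms(1)] by blast
  obtain Q' where Q': "is_delta0 (\<lambda>e. Q' (e 0) (\<lambda>i. e (Suc i)))" "\<And>e. Q e \<longleftrightarrow> (\<exists>y. Q' y e)"
    using is_sigma1_prenex[OF assms(2)] by blast
  have "is_sigma1 (\<lambda>e. \<exists>x. \<exists>y. P' x e \<or> Q' y e)"
    by (intro is_sigma1_ex is_sigma1_delta0 is_delta0_disj is_delta0_env[OF P'(1)]
        is_delta0_env[OF Q'(1)] is_term_var)
  then show ?thesis by (simp add: P' Q' ex_disj_distrib)
qed

lemma is_sigma1_imp: "is_delta0 P \<Longrightarrow> is_sigma1 Q \<Longrightarrow> is_sigma1 (\<lambda>e. P e \<longrightarrow> Q e)"
  unfolding imp_conv_disj by (rule is_sigma1_disj[OF is_sigma1_delta0[OF is_delta0_not]])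

lemma is_sigma1_bex:
  assumes "is_sigma1 (\<lambda>e. Q (e 0) (\<lambda>i. e (Suc i)))" "is_term f"
  shows "is_sigma1 (\<lambda>e. \<exists>x<f e. Q x e)"
  by (intro is_sigma1_ex is_sigma1_conj is_sigma1_delta0 is_delta0_less is_term_var
      is_term_subst[OF assms(2)] assms(1))

text \<open>Induction on the length of the initial segment: the next bound is the maximum of the old
  one and the successor of the new witness. With a \<Delta>_0 matrix, the existence of a bound is a
  \<Sigma>_1 statement.\<close>

lemma delta0_collection:
  assumes "is_delta0 (\<lambda>e. R (e 0) (e 1))" "\<And>x. x < a \<Longrightarrow> \<exists>y. R x y"
  shows "\<exists>b. \<forall>x<a. \<exists>y<b. R x y"
proof -
  have "a' \<le> a \<longrightarrow> (\<exists>b. \<forall>x<a'. \<exists>y<b. R x y)" for a'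
  proof (rule sigma1_induct[where P = "\<lambda>a'. a' \<le> a \<longrightarrow> (\<exists>b. \<forall>x<a'. \<exists>y<b. R x y)"])
    show "is_sigma1 (\<lambda>e. e 0 \<le> a \<longrightarrow> (\<exists>b. \<forall>x<e 0. \<exists>y<b. R x y))"
      by (intro is_sigma1_imp is_sigma1_ex is_sigma1_delta0 is_delta0_intros
          is_delta0_2[OF assms(1)] is_term_intros)
  next
    fix a' assume IH: "a' \<le> a \<longrightarrow> (\<exists>b. \<forall>x<a'. \<exists>y<b. R x y)"
    show "a' + 1 \<le> a \<longrightarrow> (\<exists>b. \<forall>x<a' + 1. \<exists>y<b. R x y)"
    proof
      assume "a' + 1 \<le> a"
      then have "a' < a" by (simp add: less_iff_add_1_le)
      then obtain b y where b: "\<forall>x<a'. \<exists>y<b. R x y" and y: "R a' y"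
        using IH assms(2) by (meson less_imp_le)
      have "\<exists>z<max b (y + 1). R x z" if "x < a' + 1" for x
        using b y that unfolding less_add_1_cases
        by (metis less_add_1_iff less_max_iff_disj order_refl)
      then show "\<exists>b. \<forall>x<a' + 1. \<exists>y<b. R x y" by blast
    qed
  qed simp
  then show ?thesis by blast
qed

text \<open>Collection moves the unbounded existential quantifier in front of the bounded universal
  one.\<close>

lemma is_sigma1_ball:
  assumes "is_sigma1 (\<lambda>e. Q (e 0) (\<lambda>i. e (Suc i)))" "is_term f"
  shows "is_sigma1 (\<lambda>e. \<forall>x<f e. Q x e)"
proof -
  obtain R where R: "is_delta0 (\<lambda>e. R (e 0) (\<lambda>i. e (Suc i)))"
    "\<And>e. Q (e 0) (\<lambda>i. e (Suc i)) \<longleftrightarrow> (\<exists>y. R y e)"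
    using is_sigma1_prenex[OF assms(1)] by blast
  have Q: "Q x e \<longleftrightarrow> (\<exists>y. R y (case_nat x e))" for x e
    using R(2)[of "case_nat x e"] by simp
  have tm: "is_term (\<lambda>e. case_nat (f e) (g e) i)" if "is_term f" "\<And>i. is_term (\<lambda>e. g e i)" for f g i
    using that by (cases i) simp_all
  have "is_sigma1 (\<lambda>e. \<exists>b. \<forall>x<f e. \<exists>y<b. R y (case_nat x e))"
    by (intro is_sigma1_ex is_sigma1_delta0 is_delta0_ball is_delta0_bex is_delta0_env[OF R(1)] tm
        is_term_var is_term_subst[OF assms(2)])
  moreover have "(\<forall>x<f e. Q x e) \<longleftrightarrow> (\<exists>b. \<forall>x<f e. \<exists>y<b. R y (case_nat x e))" for e
  proof -
    have "is_delta0 (\<lambda>e'. R (e' 1) (case_nat (e' 0) e))"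
      by (intro is_delta0_env[OF R(1)] tm is_term_var is_term_const)
    from delta0_collection[OF this, of "f e"] show ?thesis unfolding Q by blast
  qed
  ultimately show ?thesis by simp
qed

lemma is_sigma1_eq: "is_term f \<Longrightarrow> is_term g \<Longrightarrow> is_sigma1 (\<lambda>e. f e = g e)"
  by (intro is_sigma1_delta0 is_delta0_intros)

lemma is_sigma1_less: "is_term f \<Longrightarrow> is_term g \<Longrightarrow> is_sigma1 (\<lambda>e. f e < g e)"
  by (intro is_sigma1_delta0 is_delta0_intros)

lemma is_sigma1_le: "is_term f \<Longrightarrow> is_term g \<Longrightarrow> is_sigma1 (\<lambda>e. f e \<le> g e)"
  by (intro is_sigma1_delta0 is_delta0_intros)

lemmas is_sigma1_intros = is_sigma1_eq is_sigma1_less is_sigma1_le is_sigma1_conj is_sigma1_disj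
  is_sigma1_imp is_sigma1_bex is_sigma1_ball is_sigma1_ex

text \<open>The induction is on a strict bound for some element of \<open>P\<close>, which keeps all
  quantifiers of the induction formula bounded.\<close>

lemma delta0_least:
  assumes "is_delta0 (\<lambda>e. P (e 0))" "P x"
  shows "\<exists>y. P y \<and> (\<forall>z<y. \<not> P z)"
proof -
  have "(\<exists>z<x. P z) \<longrightarrow> (\<exists>y<x. P y \<and> (\<forall>z<y. \<not> P z))" for x
  proof (rule delta0_induct[where P = "\<lambda>x. (\<exists>z<x. P z) \<longrightarrow> (\<exists>y<x. P y \<and> (\<forall>z<y. \<not> P z))"])
    show "is_delta0 (\<lambda>e. (\<exists>z<e 0. P z) \<longrightarrow> (\<exists>y<e 0. P y \<and> (\<forall>z<y. \<not> P z)))"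
      by (intro is_delta0_intros is_delta0_1[OF assms(1)] is_term_intros)
  next
    fix x assume "(\<exists>z<x. P z) \<longrightarrow> (\<exists>y<x. P y \<and> (\<forall>z<y. \<not> P z))"
    then show "(\<exists>z<x + 1. P z) \<longrightarrow> (\<exists>y<x + 1. P y \<and> (\<forall>z<y. \<not> P z))"
      unfolding less_add_1_cases by blast
  qed simp
  from this[of "x + 1"] show ?thesis using assms(2) less_add_1_iff by blast
qed

section \<open>Coding of finite sequences in the model\<close>

definition mpair :: "mnat \<Rightarrow> mnat \<Rightarrow> mnat" where
  "mpair x y = (x + y) * (x + y) + x"

lemma le_mult_self: "x \<le> x * (x :: mnat)"
proof (cases "x = 0")
  case False
  then have "1 \<le> x" using less_iff_add_1_le[of 0 x] by (simp add: zero_less_iff_neq_zero)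
  then show ?thesis using mult_left_mono[of 1 x x] by simp
qed simp

lemma le_mpair: "x \<le> mpair x y" "y \<le> mpair x y"
proof -
  show "x \<le> mpair x y" by (simp add: mpair_def)
  have "y \<le> x + y" by simp
  also have "\<dots> \<le> (x + y) * (x + y)" by (rule le_mult_self)
  also have "\<dots> \<le> mpair x y" by (simp add: mpair_def)
  finally show "y \<le> mpair x y" .
qed

lemma mpair_mono: "x \<le> x' \<Longrightarrow> y \<le> y' \<Longrightarrow> mpair x y \<le> mpair x' y'"
  unfolding mpair_def by (intro add_mono mult_mono) simp_all

text \<open>The sum x + y is recovered as the integer square root of the code, which lies between (x
  + y)^2 and (x + y + 1)^2; then x is the difference.\<close>

lemma mpair_inject [simp]: "mpair x y = mpair x' y' \<longleftrightarrow> x = x' \<and> y = y'"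
proof -
  have le: "x' + y' \<le> x + y" if eq: "mpair x y = mpair x' y'" for x y x' y'
  proof (rule ccontr)
    assume "\<not> x' + y' \<le> x + y"
    then have "x + y + 1 \<le> x' + y'" by (simp add: not_le less_iff_add_1_le)
    then have "(x + y + 1) * (x + y + 1) \<le> (x' + y') * (x' + y')"
      by (intro mult_mono) simp_all
    also have "\<dots> \<le> mpair x y" unfolding eq by (simp add: mpair_def)
    finally have "(x + y) * (x + y) + x + (x + y + y + 1) \<le> (x + y) * (x + y) + x"
      by (simp add: mpair_def algebra_simps)
    then show False using less_iff_add_1_le[of "x + y + y"] by simp
  qed
  have "x = x' \<and> y = y'" if eq: "mpair x y = mpair x' y'"
  proof -
    have "x + y = x' + y'" using le[OF eq] le[OF eq[symmetric]] by (rule antisym[rotated])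
    then show ?thesis using eq by (auto simp: mpair_def)
  qed
  then show ?thesis by auto
qed

definition is_lth :: "mnat \<Rightarrow> mnat \<Rightarrow> bool" where
  "is_lth s l \<longleftrightarrow> (\<exists>a b. s = mpair l (mpair a b))"

definition is_entry :: "mnat \<Rightarrow> mnat \<Rightarrow> mnat \<Rightarrow> bool" where
  "is_entry s i y \<longleftrightarrow> (\<exists>l a b q. s = mpair l (mpair a b) \<and> i < l \<and>
     y < b * (i + 1) + 1 \<and> a = q * (b * (i + 1) + 1) + y)"

lemma eval_pair [simp]: "eval e (pair t u) = mpair (eval e t) (eval e u)"
  by (simp add: pair_def mpair_def)

text \<open>The components of a code do not exceed it, so the bounded quantifiers of
  \<open>lth\<close> and \<open>entry\<close> agree with the unbounded ones of \<open>is_lth\<close>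
  and \<open>is_entry\<close>.\<close>

lemma code_bounds:
  assumes "s = mpair l (mpair a b)"
  shows "l < s + 1" "a < s + 1" "b < s + 1"
  unfolding assms less_add_1_iff
  by (rule le_mpair, (rule order_trans[OF _ le_mpair(2)], rule le_mpair)+)

lemma quotient_bound: "a = q * (d + 1) + y \<Longrightarrow> q < a + (1 :: mnat)"
  unfolding less_add_1_iff by (simp add: algebra_simps)

lemma entry_value_bound: "a = q * d + y \<Longrightarrow> y \<le> (a :: mnat)"
  by simp

lemma sat_lth [simp]: "sat e (lth s l) \<longleftrightarrow> is_lth (eval e s) (eval e l)"
proof -
  have "sat e (lth s l) \<longleftrightarrow>
    (\<exists>a<eval e s + 1. \<exists>b<eval e s + 1. eval e s = mpair (eval e l) (mpair a b))"
    by (simp add: lth_def numeral_eq_Suc)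
  also have "\<dots> \<longleftrightarrow> is_lth (eval e s) (eval e l)"
    unfolding is_lth_def by (metis code_bounds(2,3))
  finally show ?thesis .
qed

lemma sat_entry [simp]: "sat e (entry s i y) \<longleftrightarrow> is_entry (eval e s) (eval e i) (eval e y)"
proof -
  let ?s = "eval e s" and ?i = "eval e i" and ?y = "eval e y"
  have "sat e (entry s i y) \<longleftrightarrow>
    (\<exists>l<?s + 1. \<exists>a<?s + 1. \<exists>b<?s + 1. ?s = mpair l (mpair a b) \<and> ?i < l \<and>
      ?y < b * (?i + 1) + 1 \<and> (\<exists>q<a + 1. a = q * (b * (?i + 1) + 1) + ?y))"
    by (simp add: entry_def numeral_eq_Suc)
  also have "\<dots> \<longleftrightarrow> is_entry ?s ?i ?y"
    unfolding is_entry_def by (metis code_bounds quotient_bound)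
  finally show ?thesis .
qed

lemma is_lth_unique: "is_lth s l \<Longrightarrow> is_lth s l' \<Longrightarrow> l = l'"
  by (auto simp: is_lth_def)

lemma is_entry_less: "is_entry s i y \<Longrightarrow> is_lth s l \<Longrightarrow> i < l"
  by (auto simp: is_lth_def is_entry_def)

lemma is_entry_lth: "is_entry s i y \<Longrightarrow> \<exists>l. is_lth s l \<and> i < l"
  by (auto simp: is_lth_def is_entry_def)

lemma is_lth_le: "is_lth s l \<Longrightarrow> l \<le> s"
  by (auto simp: is_lth_def le_mpair)

lemma is_entry_index_le: "is_entry s i y \<Longrightarrow> i \<le> s"
  using is_entry_lth is_lth_le by (meson less_imp_le order_trans)

lemma is_entry_le: "is_entry s i y \<Longrightarrow> y \<le> s"
  using code_bounds(2) unfolding is_entry_def less_add_1_iff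
  by (meson entry_value_bound order_trans)

lemma remainder_unique:
  fixes q :: mnat
  assumes "q * d + r = q' * d + r'" "r < d" "r' < d"
  shows "r = r'"
proof -
  have False if "q * d + r = q' * d + r'" "r < d" "q < q'" for q q' r r' :: mnat
  proof -
    have "(q + 1) * d \<le> q' * d"
      using that(3) by (intro mult_right_mono) (simp_all add: less_iff_add_1_le)
    then have "q * d + d \<le> q * d + r"
      unfolding that(1) by (simp add: distrib_right add_increasing2)
    then show False using that(2) by simp
  qed
  from this[of q r q' r'] this[of q' r' q r] assms have "q = q'"
    by (metis linorder_neqE)
  then show ?thesis using assms by simp
qed

lemma is_entry_unique: "is_entry s i y \<Longrightarrow> is_entry s i y' \<Longrightarrow> y = y'"
  unfolding is_entry_def using remainder_unique by auto

lemma division: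
  assumes "0 < (d :: mnat)"
  shows "\<exists>q r. a = q * d + r \<and> r < d"
proof (rule sigma1_induct[where P = "\<lambda>a. \<exists>q r. a = q * d + r \<and> r < d"])
  show "is_sigma1 (\<lambda>e. \<exists>q r. e 0 = q * d + r \<and> r < d)"
    by (intro is_sigma1_intros is_term_intros)
  show "\<exists>q r. 0 = q * d + r \<and> r < d"
    using assms by (intro exI[of _ 0]) simp
  fix a assume "\<exists>q r. a = q * d + r \<and> r < d"
  then obtain q r where a: "a = q * d + r" and r: "r < d" by blast
  show "\<exists>q r. a + 1 = q * d + r \<and> r < d"
  proof (cases "r + 1 = d")
    case True
    then show ?thesis using a assms
      by (intro exI[of _ "q + 1"] exI[of _ 0]) (auto simp: algebra_simps)
  next
    case False
    then have "r + 1 < d" using r by (simp add: less_iff_add_1_le order_less_le flip: less_iff_add_1_le)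
    then show ?thesis using a by (intro exI[of _ q] exI[of _ "r + 1"]) (auto simp: algebra_simps)
  qed
qed

lemma is_entry_exists:
  assumes "is_lth s l" "i < l"
  shows "\<exists>y. is_entry s i y"
proof -
  obtain a b where "s = mpair l (mpair a b)" using assms(1) unfolding is_lth_def by blast
  moreover obtain q r where "a = q * (b * (i + 1) + 1) + r" "r < b * (i + 1) + 1"
    using division[of "b * (i + 1) + 1" a] by (metis less_add_1_iff zero_le)
  ultimately show ?thesis using assms(2) unfolding is_entry_def by blast
qed

lemma is_delta0_entry:
  assumes "is_term f" "is_term g" "is_term h"
  shows "is_delta0 (\<lambda>e. is_entry (f e) (g e) (h e))"
proof -
  obtain t u v where "\<And>e. f e = eval (mix e) t" "\<And>e. g e = eval (mix e) u" "\<And>e. h e = eval (mix e) v"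
    using assms unfolding is_term_def by blast
  moreover have "delta0 (entry t u v)" unfolding entry_def by (intro delta0.intros)
  ultimately show ?thesis unfolding is_delta0_def by (intro exI[of _ "entry t u v"]) simp
qed

lemma is_term_pair: "is_term f \<Longrightarrow> is_term g \<Longrightarrow> is_term (\<lambda>e. mpair (f e) (g e))"
  unfolding mpair_def by (intro is_term_intros)

text \<open>The quotients on both sides avoid subtraction.\<close>

definition mcong :: "mnat \<Rightarrow> mnat \<Rightarrow> mnat \<Rightarrow> bool" where
  "mcong m x y \<longleftrightarrow> (\<exists>v w. x + m * v = y + m * w)"

lemma mcong_refl: "mcong m x x"
  by (auto simp: mcong_def)

lemma mcong_trans:
  assumes "mcong m x y" "mcong m y z"
  shows "mcong m x z"
proof -
  obtain v w v' w' where "x + m * v = y + m * w" "y + m * v' = z + m * w'"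
    using assms unfolding mcong_def by blast
  then have "x + m * (v + v') = z + m * (w + w')"
    by (simp add: distrib_left) (metis add.assoc add.commute)
  then show ?thesis unfolding mcong_def by blast
qed

lemma mcong_mult_left: "mcong m x y \<Longrightarrow> mcong m (z * x) (z * y)"
  unfolding mcong_def by (metis distrib_left mult.left_commute)

lemma mcong_mult:
  "mcong m x y \<Longrightarrow> mcong m x' y' \<Longrightarrow> mcong m (x * x') (y * y')"
  using mcong_mult_left[of m x' y' x] mcong_mult_left[of m x y y']
  by (metis mcong_trans mult.commute)

lemma mcong_add_left: "mcong m x y \<Longrightarrow> mcong m (z + x) (z + y)"
  unfolding mcong_def by (metis add.assoc)

lemma mcong_less_imp_eq:
  assumes "mcong m x y" "x < m" "y < m"
  shows "x = y"
proof -
  obtain v w where "v * m + x = w * m + y"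
    using assms(1) unfolding mcong_def by (metis add.commute mult.commute)
  then show ?thesis using assms(2,3) by (rule remainder_unique)
qed

text \<open>Coprimality as invertibility modulo \<open>m\<close>: it is \<Sigma>_1, immediately
  multiplicative, and hands the Chinese remainder step the inverse it uses.\<close>

definition mcoprime :: "mnat \<Rightarrow> mnat \<Rightarrow> bool" where
  "mcoprime a m \<longleftrightarrow> (\<exists>u. mcong m (a * u) 1)"

lemma mcoprime_mult: "mcoprime a m \<Longrightarrow> mcoprime b m \<Longrightarrow> mcoprime (a * b) m"
  unfolding mcoprime_def by (metis mcong_mult mult.assoc mult.left_commute mult_1)

lemma is_sigma1_mcoprime:
  "is_term f \<Longrightarrow> is_term g \<Longrightarrow> is_sigma1 (\<lambda>e. mcoprime (f e) (g e))"
proof (rule is_sigma1_2[where P = mcoprime])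
  show "is_sigma1 (\<lambda>e. mcoprime (e 0) (e 1))"
    unfolding mcoprime_def mcong_def by (intro is_sigma1_intros is_term_intros)
qed

text \<open>Goedel's moduli in a form free of prime numbers. Write m_i for b(i+1) + 1; for i < j the
  difference j - i divides \<open>b\<close>, which yields an explicit linear combination of m_i and
  m_j.\<close>

lemma mcoprime_beta:
  assumes "\<And>d. d < n \<Longrightarrow> \<exists>q. b = q * (d + 1)" "i < n" "j < n" "i \<noteq> j"
  shows "mcoprime (b * (i + 1) + 1) (b * (j + 1) + 1)"
proof -
  have main: "\<exists>x y. x * (b * (i + 1) + 1) + 1 = y * (b * (j + 1) + 1)"
    if "i < j" "j < n" for i j
  proof -
    obtain d where d: "j = i + (d + 1)" using \<open>i < j\<close> mnat_less_iff by blast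
    then have "d < n"
      using \<open>j < n\<close> by (metis add.commute add.assoc le_add_same_cancel1 less_add_1_iff order_less_trans zero_le)
    then obtain q where q: "b = q * (d + 1)" using assms(1) by blast
    \<comment> \<open>From (j+1) m_i - (i+1) m_j = j - i, multiplied by q(j+1): the right-hand side
      becomes b(j+1) = m_j - 1.\<close>
    have "q * (j + 1) * (j + 1) * (b * (i + 1) + 1) + 1 =
        (q * (i + 1) * (j + 1) + 1) * (b * (j + 1) + 1)"
      unfolding q d by (simp add: algebra_simps)
    then show ?thesis by blast
  qed
  show ?thesis
  proof (cases "i < j")
    case True
    then obtain x y where xy: "x * (b * (i + 1) + 1) + 1 = y * (b * (j + 1) + 1)"
      using main assms by blast
    define mi where "mi = b * (i + 1) + 1"
    define n where "n = b * (j + 1)"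
    have xy: "x * mi + 1 = y * (n + 1)" using xy by (simp add: mi_def n_def)
    \<comment> \<open>The inverse of \<open>mi\<close> is -x, and \<open>n\<close> is -1 modulo
      \<open>n + 1\<close>; hence \<open>x * n\<close>.\<close>
    have "mi * (x * n) + (n + 1) * y = mi * (x * n) + (x * mi + 1)"
      unfolding xy by (simp add: mult.commute)
    also have "\<dots> = 1 + (n + 1) * (x * mi)" by (simp add: algebra_simps)
    finally show ?thesis
      unfolding mcoprime_def mcong_def mi_def n_def by blast
  next
    case False
    then have "j < i" using assms(4) by simp
    then obtain x y where "x * (b * (j + 1) + 1) + 1 = y * (b * (i + 1) + 1)"
      using main assms by blast
    then have "(b * (i + 1) + 1) * y + (b * (j + 1) + 1) * 0 = 1 + (b * (j + 1) + 1) * x"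
      by (simp add: mult.commute add.commute)
    then show ?thesis unfolding mcoprime_def mcong_def by blast
  qed
qed

text \<open>Stands in for the factorial of the usual beta function argument: instead of defining
  that function, only the existence of a large common multiple is proved.\<close>

lemma common_multiple: "\<exists>b. n \<le> b \<and> 0 < b \<and> (\<forall>d<n. \<exists>q. b = q * (d + 1))"
  for n :: mnat
proof (rule sigma1_induct[where P = "\<lambda>n. \<exists>b. n \<le> b \<and> 0 < b \<and> (\<forall>d<n. \<exists>q. b = q * (d + 1))"])
  show "is_sigma1 (\<lambda>e. \<exists>b. e 0 \<le> b \<and> 0 < b \<and> (\<forall>d<e 0. \<exists>q. b = q * (d + 1)))"
    by (intro is_sigma1_intros is_term_intros)
  show "\<exists>b :: mnat. 0 \<le> b \<and> 0 < b \<and> (\<forall>d<0. \<exists>q. b = q * (d + 1))"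
    by (intro exI[of _ 1]) (simp add: mnat_axioms(7))
  fix n :: mnat
  assume "\<exists>b. n \<le> b \<and> 0 < b \<and> (\<forall>d<n. \<exists>q. b = q * (d + 1))"
  then obtain b where b: "0 < b" "\<And>d. d < n \<Longrightarrow> \<exists>q. b = q * (d + 1)" by blast
  have "1 * (n + 1) \<le> b * (n + 1)"
    using b(1) less_iff_add_1_le[of 0 b] by (intro mult_right_mono) simp_all
  moreover have "0 < b * (n + 1)" using b(1) by (simp add: zero_less_iff_neq_zero)
  moreover have "\<exists>q. b * (n + 1) = q * (d + 1)" if "d < n + 1" for d
    using that b(2) unfolding less_add_1_cases by (metis mult.assoc mult.commute)
  ultimately show "\<exists>b. n + 1 \<le> b \<and> 0 < b \<and> (\<forall>d<n + 1. \<exists>q. b = q * (d + 1))"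
    by (intro exI[of _ "b * (n + 1)"]) simp
qed

text \<open>The product \<open>c\<close> of the moduli used so far makes the Chinese remainder step possible.\<close>

lemma chinese_remainder:
  fixes m :: "mnat \<Rightarrow> mnat"
  assumes R: "is_delta0 (\<lambda>e. R (e 0) (e 1))"
    and m: "m = (\<lambda>i. b * (i + 1) + 1)"
    and coprime: "\<And>i j. i < l \<Longrightarrow> j < l \<Longrightarrow> i \<noteq> j \<Longrightarrow> mcoprime (m i) (m j)"
    and residues: "\<And>i. i < l \<Longrightarrow> \<exists>y < m i. R i y"
  shows "\<exists>a. \<forall>i<l. \<exists>y q. y < m i \<and> R i y \<and> a = q * m i + y"
proof -
  have "j \<le> l \<longrightarrow> (\<exists>a c. (\<forall>i<j. \<exists>y q. y < m i \<and> R i y \<and> a = q * m i + y) \<and>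
      (\<forall>i<j. \<exists>q. c = q * m i) \<and> (\<forall>i<l. j \<le> i \<longrightarrow> mcoprime c (m i)))" for j
  proof (rule sigma1_induct[where P = "\<lambda>j. j \<le> l \<longrightarrow>
        (\<exists>a c. (\<forall>i<j. \<exists>y q. y < m i \<and> R i y \<and> a = q * m i + y) \<and>
          (\<forall>i<j. \<exists>q. c = q * m i) \<and> (\<forall>i<l. j \<le> i \<longrightarrow> mcoprime c (m i)))"])
    show "is_sigma1 (\<lambda>e. e 0 \<le> l \<longrightarrow>
        (\<exists>a c. (\<forall>i<e 0. \<exists>y q. y < m i \<and> R i y \<and> a = q * m i + y) \<and>
          (\<forall>i<e 0. \<exists>q. c = q * m i) \<and> (\<forall>i<l. e 0 \<le> i \<longrightarrow> mcoprime c (m i))))"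
      unfolding m by (intro is_sigma1_intros is_delta0_intros is_sigma1_mcoprime
          is_sigma1_delta0[OF is_delta0_2[OF R]] is_term_intros)
  next
    have "mcoprime 1 (m i)" for i
      unfolding mcoprime_def by (intro exI[of _ 1]) (simp add: mcong_refl)
    then show "0 \<le> l \<longrightarrow> (\<exists>a c. (\<forall>i<0. \<exists>y q. y < m i \<and> R i y \<and> a = q * m i + y) \<and>
        (\<forall>i<0. \<exists>q. c = q * m i) \<and> (\<forall>i<l. 0 \<le> i \<longrightarrow> mcoprime c (m i)))"
      by (auto simp: mnat_axioms(7))
  next
    fix j
    assume IH: "j \<le> l \<longrightarrow> (\<exists>a c. (\<forall>i<j. \<exists>y q. y < m i \<and> R i y \<and> a = q * m i + y) \<and>
      (\<forall>i<j. \<exists>q. c = q * m i) \<and> (\<forall>i<l. j \<le> i \<longrightarrow> mcoprime c (m i)))"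
    show "j + 1 \<le> l \<longrightarrow> (\<exists>a c. (\<forall>i<j + 1. \<exists>y q. y < m i \<and> R i y \<and> a = q * m i + y) \<and>
      (\<forall>i<j + 1. \<exists>q. c = q * m i) \<and> (\<forall>i<l. j + 1 \<le> i \<longrightarrow> mcoprime c (m i)))"
    proof
      assume "j + 1 \<le> l"
      then have j: "j < l" by (simp add: less_iff_add_1_le)
      then obtain a c where a: "\<And>i. i < j \<Longrightarrow> \<exists>y q. y < m i \<and> R i y \<and> a = q * m i + y"
        and c: "\<And>i. i < j \<Longrightarrow> \<exists>q. c = q * m i"
        and cop: "\<And>i. i < l \<Longrightarrow> j \<le> i \<Longrightarrow> mcoprime c (m i)"
        using IH less_imp_le[OF j] by blast
      obtain y where y: "y < m j" "R j y" using residues[OF j] by blast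
      obtain u where u: "mcong (m j) (c * u) 1" using cop[OF j] unfolding mcoprime_def by blast
      \<comment> \<open>Modulo \<open>m j\<close> the factor b(j+1) is -1, so \<open>t\<close>
        represents y - a without subtraction. As c u is 1 modulo \<open>m j\<close>, adding c u t to
        \<open>a\<close> corrects its residue to \<open>y\<close>; the earlier residues survive
        because their moduli divide \<open>c\<close>.\<close>
      define t where "t = y + a * (b * (j + 1))"
      define a' where "a' = a + c * u * t"
      have "mcong (m j) a' (a + 1 * t)"
        unfolding a'_def by (intro mcong_add_left mcong_mult mcong_refl u)
      moreover have "a + 1 * t = y + m j * a"
        unfolding t_def m by (simp add: algebra_simps)
      moreover have "mcong (m j) (y + m j * a) y"
        unfolding mcong_def by (intro exI[of _ 0] exI[of _ a]) simp
      ultimately have y_cong: "mcong (m j) a' y" using mcong_trans by metis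
      obtain q r where r: "a' = q * m j + r" "r < m j"
        using division[of "m j" a'] y(1) by (metis order_le_less_trans zero_le)
      have "mcong (m j) r a'"
        unfolding mcong_def r by (intro exI[of _ q] exI[of _ 0]) (simp add: algebra_simps)
      then have "r = y"
        using y_cong r(2) y(1) mcong_less_imp_eq mcong_trans by blast
      then have new: "\<exists>y q. y < m j \<and> R j y \<and> a' = q * m j + y" using r y by blast
      have old: "\<exists>y q. y < m i \<and> R i y \<and> a' = q * m i + y" if i: "i < j" for i
      proof -
        obtain y q where *: "y < m i" "R i y" "a = q * m i + y" using a[OF i] by blast
        obtain q' where "c = q' * m i" using c[OF i] by blast
        then have "a' = (q + q' * u * t) * m i + y"
          unfolding a'_def *(3) by (simp add: algebra_simps)
        then show ?thesis using * by blast
      qed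
      have "\<forall>i<j + 1. \<exists>y q. y < m i \<and> R i y \<and> a' = q * m i + y"
        using old new unfolding less_add_1_cases by blast
      moreover have "\<forall>i<j + 1. \<exists>q. c * m j = q * m i"
        using c unfolding less_add_1_cases by (metis mult.assoc mult.commute)
      moreover have "\<forall>i<l. j + 1 \<le> i \<longrightarrow> mcoprime (c * m j) (m i)"
      proof (intro allI impI)
        fix i assume i: "i < l" "j + 1 \<le> i"
        then have "j < i" by (simp add: less_iff_add_1_le)
        then show "mcoprime (c * m j) (m i)"
          using i cop coprime[OF j i(1)] by (intro mcoprime_mult) auto
      qed
      ultimately show "\<exists>a c. (\<forall>i<j + 1. \<exists>y q. y < m i \<and> R i y \<and> a = q * m i + y) \<and>
        (\<forall>i<j + 1. \<exists>q. c = q * m i) \<and> (\<forall>i<l. j + 1 \<le> i \<longrightarrow> mcoprime c (m i))" by blast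
    qed
  qed
  then show ?thesis by (meson order_refl)
qed

text \<open>Any \<Delta>_0 relation that is total below \<open>l\<close> is realized by a coded
  sequence. The relation may be many-valued; the sequence then contains some choice of
  values.\<close>

theorem sequence_comprehension:
  assumes R: "is_delta0 (\<lambda>e. R (e 0) (e 1))" and ex: "\<And>i. i < l \<Longrightarrow> \<exists>y. R i y"
  shows "\<exists>s. is_lth s l \<and> (\<forall>i<l. \<exists>y. is_entry s i y \<and> R i y)"
proof -
  obtain B where B: "\<And>i. i < l \<Longrightarrow> \<exists>y<B. R i y"
    using delta0_collection[OF R] ex by blast
  \<comment> \<open>The summand \<open>l\<close> makes the first \<open>l\<close> moduli coprime;
    the summand \<open>B\<close> makes each of them exceed the values to be stored.\<close>
  obtain b where b: "l + B \<le> b" "\<And>d. d < l + B \<Longrightarrow> \<exists>q. b = q * (d + 1)"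
    using common_multiple by blast
  let ?m = "\<lambda>i. b * (i + 1) + 1"
  have "B \<le> b" using b(1) by (rule order_trans[rotated]) simp
  have less: "y < ?m i" if "y < B" for y i
  proof -
    have "y \<le> b * (i + 1)"
      using that \<open>B \<le> b\<close> by (simp add: distrib_left add_increasing)
    then show ?thesis by (simp only: less_add_1_iff)
  qed
  have "\<exists>a. \<forall>i<l. \<exists>y q. y < ?m i \<and> R i y \<and> a = q * ?m i + y"
  proof (rule chinese_remainder[OF R refl])
    show "mcoprime (?m i) (?m j)" if "i < l" "j < l" "i \<noteq> j" for i j
      using mcoprime_beta[of "l + B" b i j, OF b(2)] that
      by (meson le_add_same_cancel1 order_less_le_trans zero_le)
    show "\<exists>y<?m i. R i y" if "i < l" for i
      using B[OF that] less by blast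
  qed
  then obtain a where a: "\<And>i. i < l \<Longrightarrow> \<exists>y q. y < ?m i \<and> R i y \<and> a = q * ?m i + y" by blast
  have "\<exists>y. is_entry (mpair l (mpair a b)) i y \<and> R i y" if "i < l" for i
    using a[OF that] that unfolding is_entry_def by blast
  moreover have "is_lth (mpair l (mpair a b)) l" by (auto simp: is_lth_def)
  ultimately show ?thesis by blast
qed

section \<open>Computations of the Ackermann function in the model\<close>

definition mtriple :: "mnat \<Rightarrow> mnat \<Rightarrow> mnat \<Rightarrow> mnat" where
  "mtriple m n k = mpair m (mpair n k)"

definition is_before :: "mnat \<Rightarrow> mnat \<Rightarrow> mnat \<Rightarrow> bool" where
  "is_before s i t \<longleftrightarrow> (\<exists>j<i. is_entry s j t)"

text \<open>The set \<open>B\<close> of available triples is kept abstract and occurs only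
  positively, so a step is carried over to a longer computation by monotonicity.\<close>

definition ack_step :: "(mnat \<Rightarrow> bool) \<Rightarrow> mnat \<Rightarrow> mnat \<Rightarrow> mnat \<Rightarrow> bool" where
  "ack_step B m n k \<longleftrightarrow> m = 0 \<and> k = n + 1 \<or>
     (\<exists>m'. m = m' + 1 \<and> n = 0 \<and> B (mtriple m' 1 k)) \<or>
     (\<exists>m' n' c. m = m' + 1 \<and> n = n' + 1 \<and> B (mtriple m n' c) \<and> B (mtriple m' c k))"

definition is_comp :: "mnat \<Rightarrow> bool" where
  "is_comp s \<longleftrightarrow> (\<exists>l. is_lth s l \<and> (\<forall>i<l. \<exists>m n k.
     is_entry s i (mtriple m n k) \<and> ack_step (is_before s i) m n k))"

definition computed :: "mnat \<Rightarrow> mnat \<Rightarrow> mnat \<Rightarrow> mnat \<Rightarrow> bool" where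
  "computed s m n k \<longleftrightarrow> is_comp s \<and> (\<exists>i. is_entry s i (mtriple m n k))"

lemma eval_triple [simp]: "eval e (triple t u v) = mtriple (eval e t) (eval e u) (eval e v)"
  by (simp add: triple_def mtriple_def)

lemma sat_before [simp]: "sat e (before s i t) \<longleftrightarrow> is_before (eval e s) (eval e i) (eval e t)"
  by (simp add: before_def is_before_def)

lemma le_mtriple: "m \<le> mtriple m n k" "n \<le> mtriple m n k" "k \<le> mtriple m n k"
  unfolding mtriple_def by (rule le_mpair, (rule order_trans[OF _ le_mpair(2)], rule le_mpair)+)

lemma is_entry_triple_less:
  assumes "is_entry s i (mtriple m n k)"
  shows "m < s + 1" "n < s + 1" "k < s + 1"
  unfolding less_add_1_iff using is_entry_le[OF assms] le_mtriple order_trans by meson+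

lemma is_before_triple_less:
  assumes "is_before s i (mtriple m n k)"
  shows "m < s + 1" "n < s + 1" "k < s + 1"
  using assms is_entry_triple_less unfolding is_before_def by blast+

lemma is_lth_less: "is_lth s l \<Longrightarrow> l < s + 1"
  unfolding less_add_1_iff by (rule is_lth_le)

text \<open>All quantified numbers are components of entries of \<open>s\<close>, hence at most
  \<open>s\<close>, in accordance with the bounds in \<open>ack_comp\<close>.\<close>

lemma ack_step_bounded:
  "ack_step (is_before s i) m n k \<longleftrightarrow> m = 0 \<and> k = n + 1 \<or>
     (\<exists>m'<s + 1. m = m' + 1 \<and> n = 0 \<and> is_before s i (mtriple m' 1 k)) \<or>
     (\<exists>m'<s + 1. \<exists>n'<s + 1. \<exists>c<s + 1. m = m' + 1 \<and> n = n' + 1 \<and>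
        is_before s i (mtriple m n' c) \<and> is_before s i (mtriple m' c k))"
  unfolding ack_step_def
  by (intro arg_cong2[where f = "(\<or>)"] refl iffI) (blast dest: is_before_triple_less)+

lemma is_comp_bounded:
  "is_comp s \<longleftrightarrow> (\<exists>l<s + 1. is_lth s l \<and> (\<forall>i<l. \<exists>m<s + 1. \<exists>n<s + 1. \<exists>k<s + 1.
     is_entry s i (mtriple m n k) \<and> ack_step (is_before s i) m n k))"
  unfolding is_comp_def by (meson is_entry_triple_less is_lth_less)

lemma sat_ack_comp [simp]: "sat e (ack_comp s) \<longleftrightarrow> is_comp (eval e s)"
  unfolding is_comp_bounded ack_step_bounded by (simp add: ack_comp_def numeral_eq_Suc)

lemma sat_phi_A: "sat e (phi_A m n k) \<longleftrightarrow> (\<exists>s. computed s (eval e m) (eval e n) (eval e k))"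
proof -
  have "(\<exists>i<s + 1. is_entry s i t) \<longleftrightarrow> (\<exists>i. is_entry s i t)" for s t
    unfolding less_add_1_iff by (meson is_entry_index_le)
  then show ?thesis by (simp add: phi_A_def computed_def is_before_def)
qed

lemma is_term_triple:
  "is_term f \<Longrightarrow> is_term g \<Longrightarrow> is_term h \<Longrightarrow> is_term (\<lambda>e. mtriple (f e) (g e) (h e))"
  unfolding mtriple_def by (intro is_term_pair)

lemma is_delta0_comp:
  assumes "is_term f"
  shows "is_delta0 (\<lambda>e. is_comp (f e))"
proof -
  obtain t where "\<And>e. f e = eval (mix e) t"
    using assms unfolding is_term_def by blast
  moreover have "delta0 (ack_comp t)"
    unfolding ack_comp_def before_def entry_def lth_def by (intro delta0.intros)
  ultimately show ?thesis unfolding is_delta0_def by (intro exI[of _ "ack_comp t"]) simp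
qed

lemma ack_step_mono: "ack_step B m n k \<Longrightarrow> (\<And>t. B t \<Longrightarrow> B' t) \<Longrightarrow> ack_step B' m n k"
  unfolding ack_step_def by blast

lemma is_comp_entry:
  assumes "is_comp s" "is_entry s i t"
  shows "\<exists>m n k. t = mtriple m n k \<and> ack_step (is_before s i) m n k"
  using assms is_entry_less is_entry_unique unfolding is_comp_def by blast

text \<open>The concatenation of two computations, followed by one more step.\<close>

lemma computed_step:
  assumes s: "is_comp s" and s': "is_comp s'"
    and step: "ack_step (\<lambda>t. (\<exists>i. is_entry s i t) \<or> (\<exists>i. is_entry s' i t)) m n k"
  shows "\<exists>s. computed s m n k"
proof -
  obtain l l' where l: "is_lth s l" "is_lth s' l'"
    using s s' unfolding is_comp_def by blast
  define L where "L = l + l'"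
  \<comment> \<open>The graph of the concatenation, with the new triple at index \<open>L\<close>.
    The offset \<open>j\<close> never exceeds \<open>i\<close>, and stating this bound keeps
    \<open>R\<close> a \<Delta>_0 relation.\<close>
  define R where "R i y \<longleftrightarrow> is_entry s i y \<or> l \<le> i \<and> (\<exists>j<i + 1. i = l + j \<and> is_entry s' j y) \<or>
      i = L \<and> y = mtriple m n k" for i y
  have R_delta0: "is_delta0 (\<lambda>e. R (e 0) (e 1))"
    unfolding R_def by (intro is_delta0_intros is_delta0_entry is_term_intros)
  have R_s: "R i y \<longleftrightarrow> is_entry s i y" if "i < l" for i y
    using that unfolding R_def L_def by (metis le_add_same_cancel1 not_le zero_le)
  have R_s': "R (l + j) y \<longleftrightarrow> is_entry s' j y" if "j < l'" for j y
  proof -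
    have "\<not> is_entry s (l + j) y" using is_entry_less[OF _ l(1), of "l + j" y] by auto
    moreover have "j < l + j + 1" by (simp add: less_add_1_iff)
    ultimately show ?thesis using that unfolding R_def L_def by auto
  qed
  have R_L: "R L y \<longleftrightarrow> y = mtriple m n k" for y
  proof -
    have "\<not> is_entry s L y" using is_entry_less[OF _ l(1), of L y] by (auto simp: L_def)
    moreover have "\<not> is_entry s' l' y" using is_entry_less[OF _ l(2), of l' y] by auto
    ultimately show ?thesis unfolding R_def L_def by auto
  qed
  have cases: "i < l \<or> (\<exists>j<l'. i = l + j) \<or> i = L" if "i < L + 1" for i
  proof (cases "i < l")
    case False
    then obtain j where j: "i = l + j" unfolding not_less mnat_le_iff by blast
    then have "j \<le> l'" using that unfolding less_add_1_iff L_def by simp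
    then show ?thesis using j by (auto simp: L_def less_eq_mnat_def)
  qed simp
  have "\<exists>y. R i y" if "i < L + 1" for i
    using cases[OF that] is_entry_exists[OF l(1)] is_entry_exists[OF l(2)] R_s R_s' R_L by blast
  from sequence_comprehension[OF R_delta0 this] obtain w where w: "is_lth w (L + 1)"
    and w_R: "\<And>i. i < L + 1 \<Longrightarrow> \<exists>y. is_entry w i y \<and> R i y" by blast
  \<comment> \<open>Comprehension yields only some \<open>y\<close> related to each index;
    uniqueness shows that the entries of \<open>w\<close> are exactly those prescribed.\<close>
  have R_unique: "y = y'" if "i < L + 1" "R i y" "R i y'" for i y y'
    using cases[OF that(1)] that(2,3) R_s R_s' R_L is_entry_unique by metis
  have w_iff: "is_entry w i y \<longleftrightarrow> R i y" if "i < L + 1" for i y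
    using w_R[OF that] R_unique[OF that] is_entry_unique by metis
  have less: "i < L + 1" if "i < l" for i
    using that unfolding less_add_1_iff L_def by (simp add: add_increasing2)
  have less': "l + j < L + 1" if "j < l'" for j
    using that unfolding less_add_1_iff L_def by simp
  have w_s: "is_entry w i y" if "is_entry s i y" for i y
    using that w_iff less R_s is_entry_less[OF that l(1)] by blast
  have w_s': "is_entry w (l + j) y" if "is_entry s' j y" for j y
    using that w_iff less' R_s' is_entry_less[OF that l(2)] by blast
  have "\<exists>m n k. is_entry w i (mtriple m n k) \<and> ack_step (is_before w i) m n k" if i: "i < L + 1" for i
  proof -
    obtain y where y: "is_entry w i y" "R i y" using w_R[OF i] by blast
    consider "i < l" | j where "j < l'" "i = l + j" | "i = L" using cases[OF i] by blast
    then show ?thesis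
    proof cases
      case 1
      then obtain m n k where y': "y = mtriple m n k" and st: "ack_step (is_before s i) m n k"
        using is_comp_entry[OF s] y(2) R_s by blast
      have "ack_step (is_before w i) m n k"
        by (rule ack_step_mono[OF st]) (use w_s in \<open>auto simp: is_before_def\<close>)
      then show ?thesis using y y' by blast
    next
      case 2
      then obtain m n k where y': "y = mtriple m n k" and st: "ack_step (is_before s' j) m n k"
        using is_comp_entry[OF s'] y(2) R_s' by blast
      have "ack_step (is_before w i) m n k"
      proof (rule ack_step_mono[OF st])
        fix t assume "is_before s' j t"
        then obtain j' where "j' < j" "is_entry s' j' t" unfolding is_before_def by blast
        then show "is_before w i t"
          unfolding is_before_def 2(2) using w_s' by (intro exI[of _ "l + j'"]) simp
      qed
      then show ?thesis using y y' by blast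
    next
      case 3
      have "ack_step (is_before w i) m n k"
      proof (rule ack_step_mono[OF step])
        fix t assume "(\<exists>i. is_entry s i t) \<or> (\<exists>i. is_entry s' i t)"
        then show "is_before w i t"
        proof (elim disjE exE)
          fix i' assume t: "is_entry s i' t"
          then have "i' < L"
            using is_entry_less[OF t l(1)] unfolding L_def by (meson le_add_same_cancel1 order_less_le_trans zero_le)
          then show ?thesis unfolding is_before_def 3 using w_s[OF t] by blast
        next
          fix j assume t: "is_entry s' j t"
          then have "l + j < L" using is_entry_less[OF t l(2)] unfolding L_def by simp
          then show ?thesis unfolding is_before_def 3 using w_s'[OF t] by blast
        qed
      qed
      moreover have "y = mtriple m n k" using y(2) R_L by (simp only: 3)
      ultimately show ?thesis using y(1) by blast
    qed
  qed
  then have "is_comp w" unfolding is_comp_def using w by blast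
  moreover have "is_entry w L (mtriple m n k)" using w_iff[of L] R_L by (simp add: less_add_1_iff)
  ultimately show ?thesis unfolding computed_def by blast
qed

lemma computed_0: "\<exists>s. computed s 0 n (n + 1)"
proof -
  \<comment> \<open>The number 0 is the pair of 0 and the pair of 0 and 0, hence a code of the empty
    sequence.\<close>
  have "is_comp 0"
    unfolding is_comp_def is_lth_def
    by (rule exI[of _ 0]) (auto simp: mpair_def mnat_axioms(7) intro: exI[of _ 0])
  then show ?thesis
    by (rule computed_step[of 0 0]) (simp_all add: ack_step_def \<open>is_comp 0\<close>)
qed

lemma computed_Suc_0: "computed s m 1 k \<Longrightarrow> \<exists>s. computed s (m + 1) 0 k"
  unfolding computed_def[of s] by (elim conjE, rule computed_step[of s s]) (auto simp: ack_step_def)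

lemma computed_Suc_Suc:
  "computed s (m + 1) n c \<Longrightarrow> computed s' m c k \<Longrightarrow> \<exists>s. computed s (m + 1) (n + 1) k"
  unfolding computed_def[of s] computed_def[of s']
  by (elim conjE, rule computed_step[of s s']) (auto simp: ack_step_def)

section \<open>Totality\<close>

lemma sat_inst_2: "sat e (inst d [t, u] p) =
    sat (case_nat (eval e t) (case_nat (eval e u) (\<lambda>i. e (i + d)))) p"
proof -
  have "(if i < length [t, u] then eval e ([t, u] ! i) else e (i - length [t, u] + d)) =
      case_nat (eval e t) (case_nat (eval e u) (\<lambda>i. e (i + d))) i" for i
    by (auto simp: less_Suc_eq split: nat.split)
  then show ?thesis by (simp only: sat_inst)
qed

lemma sat_PFUN: "sat e (PFUN p) \<longleftrightarrow> (\<forall>x y y'. sat (case_nat x (case_nat y e)) p \<longrightarrow>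
    sat (case_nat x (case_nat y' e)) p \<longrightarrow> y = y')"
  by (auto simp: PFUN_def sat_inst_2 numeral_eq_Suc)

lemma sat_Approx: "sat e (Approx d p s) \<longleftrightarrow>
    (\<exists>l. is_lth (eval e s) l \<and> (\<forall>i. i + 1 < l \<longrightarrow> (\<exists>u v. is_entry (eval e s) i u \<and>
      is_entry (eval e s) (i + 1) v \<and>
      (\<forall>x y. x \<le> u \<and> sat (case_nat x (case_nat y (\<lambda>i. e (i + d)))) p \<longrightarrow> y \<le> v))))"
  by (simp add: Approx_def sat_inst_2 numeral_eq_Suc less_eq_mnat_def)

lemma approximation:
  assumes P: "\<And>p (e :: nat \<Rightarrow> mnat). ucl p \<in> PSigma1 \<Longrightarrow> sat e p"
    and F: "is_sigma1 (\<lambda>e. F (e 0) (e 1))"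
    and functional: "\<And>x y y'. F x y \<Longrightarrow> F x y' \<Longrightarrow> y = y'"
  shows "\<exists>s. \<forall>i. i + 1 < z \<longrightarrow> (\<exists>u v. is_entry s i u \<and> is_entry s (i + 1) v \<and>
    (\<forall>x y. x \<le> u \<longrightarrow> F x y \<longrightarrow> y \<le> v))"
proof -
  obtain p c where p: "sigma1 p" "\<And>x y. sat (case_nat x (case_nat y c)) p \<longleftrightarrow> F x y"
    using sigma1_formula_2[OF F] by blast
  have "ucl (P_ax p) \<in> PSigma1" using p(1) by (auto simp: PSigma1_def)
  then have "sat c (P_ax p)" by (rule P)
  moreover have "sat c (PFUN p)" unfolding sat_PFUN p(2) using functional by blast
  ultimately have "\<exists>s. sat (case_nat s (case_nat z c)) (Approx 2 p (Var 0)) \<and> is_lth s z"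
    by (simp add: P_ax_def)
  then show ?thesis
    unfolding sat_Approx by (simp add: p(2) numeral_eq_Suc) (metis is_lth_unique)
qed

text \<open>
  The least bound on a computation of \<open>A(m, n)\<close> is a functional, bounded formula, whether or not the
  value is unique.  The two further conditions on \<open>y\<close> make the entries of an approximation large
  enough to start with \<open>(m\<^sub>0, n\<^sub>0)\<close>, and to bound the pair formed from the next argument.
\<close>

definition ack_bound :: "mnat \<Rightarrow> mnat \<Rightarrow> mnat \<Rightarrow> mnat \<Rightarrow> bool" where
  "ack_bound m\<^sub>0 n\<^sub>0 x y \<longleftrightarrow> mpair m\<^sub>0 (n\<^sub>0 + 1) \<le> y \<and>
     (\<exists>m<y + 1. \<exists>n<y + 1. \<exists>k<y + 1. \<exists>s<y + 1. \<exists>i<y + 1.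
        x = mpair m n \<and> mpair m\<^sub>0 k \<le> y \<and> is_comp s \<and> is_entry s i (mtriple m n k))"

lemma ack_bound_exists:
  assumes "computed s m n k"
  shows "\<exists>y. ack_bound m\<^sub>0 n\<^sub>0 (mpair m n) y"
proof -
  obtain i where i: "is_comp s" "is_entry s i (mtriple m n k)"
    using assms unfolding computed_def by blast
  let ?y = "mpair m\<^sub>0 (n\<^sub>0 + 1) + (m + (n + (k + (s + (i + mpair m\<^sub>0 k)))))"
  have "m < ?y + 1" "n < ?y + 1" "k < ?y + 1" "s < ?y + 1" "i < ?y + 1"
    unfolding less_add_1_iff by (simp_all add: add_increasing add_increasing2)
  moreover have "mpair m\<^sub>0 (n\<^sub>0 + 1) \<le> ?y" "mpair m\<^sub>0 k \<le> ?y"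
    by (simp_all add: add_increasing add_increasing2)
  ultimately show ?thesis using i unfolding ack_bound_def by blast
qed

text \<open>The value comes from the computation found below \<open>y\<close>, possibly another one
  than that from which the bound arose; it is the value with which the recursion continues.\<close>

lemma ack_bound_computed:
  assumes "ack_bound m\<^sub>0 n\<^sub>0 (mpair m n) y"
  shows "\<exists>s k. computed s m n k \<and> mpair m\<^sub>0 k \<le> y"
  using assms unfolding ack_bound_def computed_def by auto

lemma is_delta0_ack_bound: "is_delta0 (\<lambda>e. ack_bound m\<^sub>0 n\<^sub>0 (e 0) (e 1))"
  unfolding ack_bound_def
  by (intro is_delta0_intros is_delta0_comp is_delta0_entry is_term_triple is_term_pair is_term_intros)

lemma is_sigma1_computed:
  assumes "is_term f" "is_term g"
  shows "is_sigma1 (\<lambda>e. \<exists>s k. computed s (f e) (g e) k)"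
proof (rule is_sigma1_2[OF _ assms])
  show "is_sigma1 (\<lambda>e. \<exists>s k. computed s (e 0) (e 1) k)"
    unfolding computed_def
    by (intro is_sigma1_intros is_sigma1_delta0[OF is_delta0_comp]
        is_sigma1_delta0[OF is_delta0_entry] is_term_triple is_term_intros)
qed

text \<open>
  If every value \<open>A(m, n)\<close> with \<open>\<langle>m\<^sub>0, n\<rangle>\<close> below the next entry exists, then so does every value
  \<open>A(m + 1, n)\<close> with \<open>\<langle>m\<^sub>0, n\<rangle>\<close> below the present one, by an induction on \<open>n\<close> alone.
\<close>

lemma ack_descend:
  assumes m: "m + 1 \<le> m\<^sub>0"
    and below: "\<And>n. mpair m\<^sub>0 n \<le> v \<Longrightarrow> \<exists>s k. computed s m n k"
    and bound: "\<And>x. x \<le> u \<Longrightarrow> \<exists>y. ack_bound m\<^sub>0 n\<^sub>0 x y \<Longrightarrow> \<exists>y\<le>v. ack_bound m\<^sub>0 n\<^sub>0 x y"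
    and v: "mpair m\<^sub>0 (n\<^sub>0 + 1) \<le> v"
    and n: "mpair m\<^sub>0 n \<le> u"
  shows "\<exists>s k. computed s (m + 1) n k"
proof -
  have "mpair m\<^sub>0 n \<le> u \<longrightarrow> (\<exists>s k. computed s (m + 1) n k)" for n
  proof (rule sigma1_induct[where P = "\<lambda>n. mpair m\<^sub>0 n \<le> u \<longrightarrow> (\<exists>s k. computed s (m + 1) n k)"])
    show "is_sigma1 (\<lambda>e. mpair m\<^sub>0 (e 0) \<le> u \<longrightarrow> (\<exists>s k. computed s (m + 1) (e 0) k))"
      by (intro is_sigma1_imp is_delta0_intros is_sigma1_computed is_term_pair is_term_intros)
    \<comment> \<open>The base case A(m+1, 0) = A(m, 1) needs the argument 1 within the range
      covered by \<open>v\<close>; the successor in \<open>n\<^sub>0 + 1\<close> guarantees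
      this.\<close>
    have "mpair m\<^sub>0 1 \<le> v"
      using v by (rule order_trans[rotated]) (intro mpair_mono; simp)
    then show "mpair m\<^sub>0 0 \<le> u \<longrightarrow> (\<exists>s k. computed s (m + 1) 0 k)"
      using below computed_Suc_0 by blast
  next
    fix n assume IH: "mpair m\<^sub>0 n \<le> u \<longrightarrow> (\<exists>s k. computed s (m + 1) n k)"
    show "mpair m\<^sub>0 (n + 1) \<le> u \<longrightarrow> (\<exists>s k. computed s (m + 1) (n + 1) k)"
    proof
      assume n1: "mpair m\<^sub>0 (n + 1) \<le> u"
      have n: "mpair m\<^sub>0 n \<le> u"
        using n1 by (rule order_trans[rotated]) (intro mpair_mono; simp)
      then obtain s k where "computed s (m + 1) n k" using IH by blast
      \<comment> \<open>Monotonicity of pairing brings the present argument below \<open>u\<close>,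
        so that its least bound, and with it the next argument \<open>c\<close>, is controlled by
        \<open>v\<close>.\<close>
      moreover have "mpair (m + 1) n \<le> u"
        using n by (rule order_trans[rotated]) (intro mpair_mono m order_refl)
      ultimately obtain y where "y \<le> v" "ack_bound m\<^sub>0 n\<^sub>0 (mpair (m + 1) n) y"
        using bound ack_bound_exists by meson
      then obtain s c where c: "computed s (m + 1) n c" "mpair m\<^sub>0 c \<le> v"
        using ack_bound_computed order_trans by meson
      then obtain s' k where "computed s' m c k" using below by blast
      then show "\<exists>s k. computed s (m + 1) (n + 1) k"
        using computed_Suc_Suc[OF c(1)] by blast
    qed
  qed
  then show ?thesis using n by blast
qed

theorem ack_total:
  assumes P: "\<And>p (e :: nat \<Rightarrow> mnat). ucl p \<in> PSigma1 \<Longrightarrow> sat e p"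
  shows "\<exists>s k. computed s m\<^sub>0 n\<^sub>0 k"
proof -
  let ?G = "ack_bound m\<^sub>0 n\<^sub>0"
  define F where "F x y \<longleftrightarrow> ?G x y \<and> (\<forall>y'<y. \<not> ?G x y')" for x y
  have "is_delta0 (\<lambda>e. F (e 0) (e 1))"
    unfolding F_def by (intro is_delta0_intros is_delta0_2[OF is_delta0_ack_bound] is_term_intros)
  then have F_sigma1: "is_sigma1 (\<lambda>e. F (e 0) (e 1))" by (rule is_sigma1_delta0)
  have F_unique: "y = y'" if "F x y" "F x y'" for x y y'
    using that unfolding F_def by (meson linorder_neqE)
  have F_exists: "\<exists>y. F x y" if G: "?G x y" for x y
  proof -
    have "is_delta0 (\<lambda>e. ?G x (e 0))"
      by (intro is_delta0_2[OF is_delta0_ack_bound] is_term_intros)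
    from delta0_least[OF this, of y] G show ?thesis unfolding F_def by blast
  qed
  \<comment> \<open>Row 0 uses the entry with index \<open>m\<^sub>0 + 1\<close>, row
    \<open>m\<^sub>0\<close> the one with index 1. Index 0 is added so that the entry at index 1 is
    itself a bound and therefore large.\<close>
  have "\<exists>s. \<forall>i. i + 1 < m\<^sub>0 + 1 + 1 \<longrightarrow> (\<exists>u v. is_entry s i u \<and> is_entry s (i + 1) v \<and>
      (\<forall>x y. x \<le> u \<longrightarrow> F x y \<longrightarrow> y \<le> v))"
    by (rule approximation) (fact P F_sigma1 F_unique)+
  then obtain s where s: "\<And>i. i + 1 < m\<^sub>0 + 1 + 1 \<Longrightarrow> \<exists>u v. is_entry s i u \<and>
      is_entry s (i + 1) v \<and> (\<forall>x y. x \<le> u \<longrightarrow> F x y \<longrightarrow> y \<le> v)"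
    by blast
  have next_entry: "\<exists>v. is_entry s (i + 1) v \<and> mpair m\<^sub>0 (n\<^sub>0 + 1) \<le> v \<and>
      (\<forall>u x. is_entry s i u \<longrightarrow> x \<le> u \<longrightarrow> (\<exists>y. ?G x y) \<longrightarrow> (\<exists>y\<le>v. ?G x y))" if i: "i \<le> m\<^sub>0" for i
  proof -
    have "i + 1 < m\<^sub>0 + 1 + 1" using i by (simp add: less_add_1_iff)
    then obtain u v where uv: "is_entry s i u" "is_entry s (i + 1) v"
      "\<And>x y. x \<le> u \<Longrightarrow> F x y \<Longrightarrow> y \<le> v" using s by blast
    \<comment> \<open>The pair of 0 and 0 is the number 0, which lies below any entry
      \<open>u\<close>. Since \<open>F\<close> is defined there, every later entry is at least
      \<open>mpair m\<^sub>0 (n\<^sub>0 + 1)\<close>.\<close>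
    obtain t where "computed t 0 0 (0 + 1)" using computed_0 by blast
    then obtain y where "F (mpair 0 0) y" using ack_bound_exists F_exists by meson
    then have "y \<le> v" "mpair m\<^sub>0 (n\<^sub>0 + 1) \<le> y"
      using uv(3)[of 0] by (auto simp: mpair_def F_def ack_bound_def)
    then have v: "mpair m\<^sub>0 (n\<^sub>0 + 1) \<le> v" by (rule order_trans[rotated])
    have "\<exists>y\<le>v. ?G x y" if x: "is_entry s i u'" "x \<le> u'" "?G x y" for u' x y
    proof -
      obtain y' where "F x y'" using F_exists[OF x(3)] by blast
      moreover have "x \<le> u" using x is_entry_unique uv(1) by metis
      ultimately show ?thesis using uv(3) unfolding F_def by blast
    qed
    then show ?thesis using uv(2) v by blast
  qed
  \<comment> \<open>The equation \<open>i + j = m\<^sub>0\<close> replaces a subtraction. The bound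
    on \<open>n\<close> follows from the pair being at most \<open>u\<close>; stated explicitly, it
    makes the universal quantifier bounded and the formula \<Sigma>_1.\<close>
  have "j \<le> m\<^sub>0 \<longrightarrow> (\<exists>i<m\<^sub>0 + 1. i + j = m\<^sub>0 \<and> (\<exists>u. is_entry s (i + 1) u \<and>
      (\<forall>n<u + 1. mpair m\<^sub>0 n \<le> u \<longrightarrow> (\<exists>s k. computed s j n k))))" for j
  proof (rule sigma1_induct[where P = "\<lambda>j. j \<le> m\<^sub>0 \<longrightarrow> (\<exists>i<m\<^sub>0 + 1. i + j = m\<^sub>0 \<and>
      (\<exists>u. is_entry s (i + 1) u \<and>
      (\<forall>n<u + 1. mpair m\<^sub>0 n \<le> u \<longrightarrow> (\<exists>s k. computed s j n k))))"])
    show "is_sigma1 (\<lambda>e. e 0 \<le> m\<^sub>0 \<longrightarrow> (\<exists>i<m\<^sub>0 + 1. i + e 0 = m\<^sub>0 \<and>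
      (\<exists>u. is_entry s (i + 1) u \<and>
      (\<forall>n<u + 1. mpair m\<^sub>0 n \<le> u \<longrightarrow> (\<exists>s k. computed s (e 0) n k)))))"
      by (intro is_sigma1_imp is_sigma1_bex is_sigma1_ball is_sigma1_conj is_delta0_le is_sigma1_eq
          is_sigma1_computed is_sigma1_delta0[OF is_delta0_entry]
          is_sigma1_ex[where Q = "\<lambda>u e. is_entry s (_ e) u \<and> _ e u"] is_term_pair is_term_intros)
  next
    show "0 \<le> m\<^sub>0 \<longrightarrow> (\<exists>i<m\<^sub>0 + 1. i + 0 = m\<^sub>0 \<and> (\<exists>u. is_entry s (i + 1) u \<and>
      (\<forall>n<u + 1. mpair m\<^sub>0 n \<le> u \<longrightarrow> (\<exists>s k. computed s 0 n k))))"
    proof -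
      obtain v where v: "is_entry s (m\<^sub>0 + 1) v" using next_entry[of m\<^sub>0] by blast
      have "m\<^sub>0 < m\<^sub>0 + 1" "m\<^sub>0 + 0 = m\<^sub>0" by (simp_all add: less_add_1_iff)
      then show ?thesis using v computed_0 by blast
    qed
  next
    fix j assume IH: "j \<le> m\<^sub>0 \<longrightarrow> (\<exists>i<m\<^sub>0 + 1. i + j = m\<^sub>0 \<and> (\<exists>u. is_entry s (i + 1) u \<and>
      (\<forall>n<u + 1. mpair m\<^sub>0 n \<le> u \<longrightarrow> (\<exists>s k. computed s j n k))))"
    show "j + 1 \<le> m\<^sub>0 \<longrightarrow> (\<exists>i<m\<^sub>0 + 1. i + (j + 1) = m\<^sub>0 \<and> (\<exists>u. is_entry s (i + 1) u \<and>
      (\<forall>n<u + 1. mpair m\<^sub>0 n \<le> u \<longrightarrow> (\<exists>s k. computed s (j + 1) n k))))"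
    proof
      assume j: "j + 1 \<le> m\<^sub>0"
      then obtain i where i: "m\<^sub>0 = (j + 1) + i" unfolding mnat_le_iff by blast
      have "j \<le> m\<^sub>0" using j less_iff_add_1_le less_imp_le by blast
      then obtain i' v where "i' + j = m\<^sub>0" and v: "is_entry s (i' + 1) v"
        "\<And>n. n < v + 1 \<Longrightarrow> mpair m\<^sub>0 n \<le> v \<Longrightarrow> \<exists>s k. computed s j n k"
        using IH by blast
      \<comment> \<open>Row \<open>j\<close> is attached to the entry right after the one for row
        \<open>j + 1\<close>, as \<open>ack_descend\<close> expects.\<close>
      then have i': "i' = i + 1" unfolding i by (metis add.assoc add.commute add_left_cancel)
      have below: "\<exists>s k. computed s j n k" if "mpair m\<^sub>0 n \<le> v" for n
        using v(2)[of n] that le_mpair(2)[of n m\<^sub>0] order_trans unfolding less_add_1_iff by blast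
      have le: "i \<le> m\<^sub>0" "i + 1 \<le> m\<^sub>0" unfolding i
        using add_increasing[of j "i + 1" "i + 1"] by (simp_all add: algebra_simps add_increasing add_increasing2)
      obtain u where u: "is_entry s (i + 1) u" using next_entry[OF le(1)] by blast
      obtain v' where v': "is_entry s (i + 1 + 1) v'" "mpair m\<^sub>0 (n\<^sub>0 + 1) \<le> v'"
        "\<And>u x. is_entry s (i + 1) u \<Longrightarrow> x \<le> u \<Longrightarrow> \<exists>y. ?G x y \<Longrightarrow> \<exists>y\<le>v'. ?G x y"
        using next_entry[OF le(2)] by blast
      have "v' = v" using v(1) v'(1) is_entry_unique unfolding i' by blast
      then have "\<exists>s k. computed s (j + 1) n k" if "mpair m\<^sub>0 n \<le> u" for n
        using ack_descend[OF j below, of v u n\<^sub>0 n] v' u that by blast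
      then show "\<exists>i<m\<^sub>0 + 1. i + (j + 1) = m\<^sub>0 \<and> (\<exists>u. is_entry s (i + 1) u \<and>
        (\<forall>n<u + 1. mpair m\<^sub>0 n \<le> u \<longrightarrow> (\<exists>s k. computed s (j + 1) n k)))"
        using u le(1) i unfolding less_add_1_iff by (intro exI[of _ i]) (auto simp: add.commute)
    qed
  qed
  from this[of m\<^sub>0] obtain u where u: "is_entry s 1 u"
    "\<And>n. n < u + 1 \<Longrightarrow> mpair m\<^sub>0 n \<le> u \<Longrightarrow> \<exists>s k. computed s m\<^sub>0 n k"
    by auto
  \<comment> \<open>The entry at index 1 follows entry 0, and hence is large enough to cover the
    argument \<open>n\<^sub>0\<close> in row \<open>m\<^sub>0\<close>.\<close>
  have "mpair m\<^sub>0 (n\<^sub>0 + 1) \<le> u"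
    using next_entry[of 0] is_entry_unique[OF u(1)] by auto
  then have "mpair m\<^sub>0 n\<^sub>0 \<le> u"
    by (rule order_trans[rotated]) (intro mpair_mono; simp)
  moreover have "n\<^sub>0 \<le> mpair m\<^sub>0 n\<^sub>0" by (rule le_mpair)
  ultimately show ?thesis using u(2) unfolding less_add_1_iff by (meson order_trans)
qed

theorem theorem3p1:
  shows "PSigma1 \<turnstile> Forall (Forall (Exists (phi_A (Var 2) (Var 1) (Var 0))))"
proof (rule provable_totality)
  fix e :: "nat \<Rightarrow> mnat"
  assume "\<And>p (e :: nat \<Rightarrow> mnat). ucl p \<in> PSigma1 \<Longrightarrow> sat e p"
  then have "\<exists>s k. computed s m n k" for m n by (rule ack_total)
  then show "sat e totality"
    by (simp add: sat_phi_A numeral_eq_Suc) blast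
qed

end
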